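(* Let $r\ge3$ and let $\mathscr T$ be the infinite $r$-regular tree with graph distance $d_{\mathscr T}$. Let $\psi=(\psi(x))_{x\in\mathscr T}$ be the Gaussian free field on $\mathscr T$, i.e. the centred Gaussian field with covariance \[ \mathbb{E}[\psi(x)\psi(y)]=g(x,y)=\frac{r-1}{r-2}\Big(\frac{1}{r-1}\Big)^{d_{\mathscr T}(x,y)},\qquad x,y\in\mathscr T. \] For each $N$ let $V_N\subset\mathscr T$ be a subtree with $N$ vertices. Set $\sigma_r^2=\frac{r-1}{r-2}$, $a_N=\sqrt{2\log N}-\frac{\log\log N+\log(4\pi)}{2\sqrt{2\log N}}$, $b_N=a_N^{-1}$, $Z_x=\psi(x)/\sigma_r$, and \[ \mathcal P_N=\sum_{x\in V_N}\delta_{(Z_x-a_N)/b_N},\qquad M_N=\max_{x\in V_N}\frac{Z_x-a_N}{b_N}. \] Let $\mathcal P_\infty$ be a Poisson point process on $\mathbb{R}$ with intensity $e^{-x}\,\mathrm{d}x$ and $M_\infty=\max\mathcal P_\infty$. Then $(\mathcal P_N,M_N)\Rightarrow(\mathcal P_\infty,M_\infty)$ jointly in distribution as $N\to\infty$. In particular, $M_N$ converges in distribution to the standard Gumbel law.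
   Context: Point processes on $\mathbb{R}$ are random counting measures, with convergence in distribution in the vague topology (equivalently, convergence of Laplace functionals for all smooth non-decreasing $\varphi$ vanishing on $(-\infty,-K]$ and constant on $[K,\infty)$ for some $K$). The standard Gumbel law has distribution function $\exp(-e^{-t})$. *)

theory Defs
  imports "HOL-Probability.Probability"
begin

definition infinite_regular_tree :: "nat \<Rightarrow> ('v \<Rightarrow> 'v \<Rightarrow> bool) \<Rightarrow> bool" where
  "infinite_regular_tree r adj \<longleftrightarrow>
     (\<forall>x y. adj x y \<longrightarrow> adj y x) \<and>
     (\<forall>x. \<not> adj x x) \<and>
     (\<forall>x. finite {y. adj x y} \<and> card {y. adj x y} = r) \<and>
     (\<forall>x y. adj\<^sup>*\<^sup>* x y) \<and>
     \<comment> \<open>acyclic: every edge is a bridge\<close>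
     (\<forall>x y. adj x y \<longrightarrow> \<not> (\<lambda>u v. adj u v \<and> {u, v} \<noteq> {x, y})\<^sup>*\<^sup>* x y) \<and>
     infinite (UNIV :: 'v set)"

definition graph_dist :: "('v \<Rightarrow> 'v \<Rightarrow> bool) \<Rightarrow> 'v \<Rightarrow> 'v \<Rightarrow> nat" where
  "graph_dist adj x y = (LEAST n. (adj ^^ n) x y)"

definition is_subtree :: "('v \<Rightarrow> 'v \<Rightarrow> bool) \<Rightarrow> 'v set \<Rightarrow> bool" where
  "is_subtree adj V \<longleftrightarrow> finite V \<and>
     (\<forall>x\<in>V. \<forall>y\<in>V. (\<lambda>u v. adj u v \<and> u \<in> V \<and> v \<in> V)\<^sup>*\<^sup>* x y)"

definition tree_green :: "nat \<Rightarrow> ('v \<Rightarrow> 'v \<Rightarrow> bool) \<Rightarrow> 'v \<Rightarrow> 'v \<Rightarrow> real" where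
  "tree_green r adj x y =
     (real r - 1) / (real r - 2) * (1 / (real r - 1)) ^ graph_dist adj x y"

text \<open>A centred Gaussian field with covariance \<open>cov\<close>: every finite linear combination
  of the field is a real random variable whose characteristic function is that of the
  centred normal law with the variance determined by \<open>cov\<close> (this also covers degenerate
  combinations).\<close>
definition centred_gaussian_field ::
  "'a measure \<Rightarrow> ('v \<Rightarrow> 'a \<Rightarrow> real) \<Rightarrow> ('v \<Rightarrow> 'v \<Rightarrow> real) \<Rightarrow> bool" where
  "centred_gaussian_field M psi cov \<longleftrightarrow>
     prob_space M \<and>
     (\<forall>x. psi x \<in> borel_measurable M) \<and>
     (\<forall>S c t. finite S \<longrightarrow>
        char (distr M borel (\<lambda>\<omega>. \<Sum>x\<in>S. c x * psi x \<omega>)) t =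
        exp (- complex_of_real ((\<Sum>x\<in>S. \<Sum>y\<in>S. c x * c y * cov x y) * t\<^sup>2 / 2)))"

definition intensity_exp :: "real set \<Rightarrow> real" where
  "intensity_exp A = (\<integral>x. indicator A x * exp (- x) \<partial>lborel)"

definition is_PPP_exp :: "'b measure \<Rightarrow> ('b \<Rightarrow> real measure) \<Rightarrow> bool" where
  "is_PPP_exp L Pp \<longleftrightarrow>
     prob_space L \<and>
     (\<forall>\<omega>. sets (Pp \<omega>) = sets borel) \<and>
     (\<forall>A\<in>sets borel. (\<lambda>\<omega>. emeasure (Pp \<omega>) A) \<in> borel_measurable L) \<and>
     (\<forall>A\<in>sets borel. bounded A \<longrightarrow> (\<forall>k::nat.
        measure L {\<omega>\<in>space L. emeasure (Pp \<omega>) A = of_nat k} =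
        exp (- intensity_exp A) * intensity_exp A ^ k / fact k)) \<and>
     (\<forall>I (A :: nat \<Rightarrow> real set). finite I \<longrightarrow> (\<forall>i\<in>I. A i \<in> sets borel \<and> bounded (A i)) \<longrightarrow>
        disjoint_family_on A I \<longrightarrow>
        prob_space.indep_vars L (\<lambda>_. borel) (\<lambda>i \<omega>. emeasure (Pp \<omega>) (A i)) I)"

text \<open>The maximum of a (counting) measure on \<open>\<real>\<close>: the infimum of the levels above which
  there are no points (for a locally finite counting measure with finitely many points
  above each level this is its largest atom).\<close>
definition pp_max :: "real measure \<Rightarrow> real" where
  "pp_max P = Inf {t. emeasure P {t<..} = 0}"

definition smooth_real :: "(real \<Rightarrow> real) \<Rightarrow> bool" where
  "smooth_real f \<longleftrightarrow> (\<forall>k x. ((deriv ^^ k) f) differentiable (at x))"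

definition pp_test_fun :: "(real \<Rightarrow> real) \<Rightarrow> bool" where
  "pp_test_fun \<phi> \<longleftrightarrow> smooth_real \<phi> \<and> mono \<phi> \<and>
     (\<exists>K>0. (\<forall>x\<le>-K. \<phi> x = 0) \<and> (\<forall>x\<ge>K. \<phi> x = \<phi> K))"

definition bounded_continuous :: "(real \<Rightarrow> real) \<Rightarrow> bool" where
  "bounded_continuous h \<longleftrightarrow> continuous_on UNIV h \<and> bounded (range h)"

definition aN :: "nat \<Rightarrow> real" where
  "aN N = sqrt (2 * ln (real N)) - (ln (ln (real N)) + ln (4 * pi)) / (2 * sqrt (2 * ln (real N)))"

definition bN :: "nat \<Rightarrow> real" where
  "bN N = 1 / aN N"

text \<open>Standard Gumbel law: distribution function \<open>exp(-e^{-t})\<close>.\<close>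
definition gumbel :: "real measure" where
  "gumbel = density lborel (\<lambda>t. ennreal (exp (- t - exp (- t))))"

end

theory Submission
  imports Defs "HOL-Real_Asymp.Real_Asymp"
begin

text \<open>For a nonincreasing \<open>f\<close> with values in \<open>[0,1]\<close> that equals \<open>1\<close> near \<open>-\<infinity>\<close>, the expectation of
  the product of \<open>f\<close> over the rescaled values on \<open>V N\<close> converges to
  \<open>exp (- (\<integral>s. (1 - f s) * exp (- s)))\<close>. Removing one vertex \<open>k\<close> at a time reduces this to a bound
  on the covariance of \<open>g (Z k)\<close> with the product over the remaining vertices, where \<open>g = 1 - f\<close>. If
  \<open>Z k\<close> is replaced by an independent copy \<open>z\<close>, and every \<open>Z i\<close> by \<open>Z i + rho i k * (z - Z k)\<close>, the new
  product is independent of \<open>Z k\<close>; so the covariance is at most the sum over \<open>i\<close> of the expectations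
  of \<open>g (Z k) * \<bar>g (Z i) - g (Z i + rho i k * (z - Z k))\<bar>\<close>. The few vertices with correlation at least
  \<open>\<theta> = N powr (- 1 / 12)\<close> contribute little because correlations are at most \<open>1 / 2\<close>, and the others
  because the replacement moves \<open>Z i\<close> by at most \<open>\<delta> = N powr (- 1 / 24)\<close> with overwhelming probability.

  The choice \<open>f s = exp (- \<phi> s) * indicator {..t} s\<close> gives the convergence of the distribution
  functions of the maximum under the law weighted by \<open>exp (- (\<Sum>x. \<phi> (Y x)))\<close>, hence weak
  convergence of these laws; the limit is identified by the Laplace functional of the Poisson process,
  evaluated at a function with value \<open>\<infinity>\<close> on \<open>{t<..}\<close>.\<close>

section \<open>Uniqueness for joint characteristic functions\<close>

text \<open>The exponents balance the errors. Two vertices with correlation at most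
  \<open>1 / 2\<close> both exceed \<open>u = aN N - K / aN N\<close> with probability at most
  \<open>exp (- 2 * u\<^sup>2 / 3)\<close>, which is \<open>N powr (- 4 / 3)\<close> up to
  logarithms. At most \<open>N / \<theta>\<^sup>2 = N powr (7 / 6)\<close> pairs have correlation at
  least \<open>\<theta>\<close>, so a factor \<open>N powr (- 1 / 6)\<close> is left. For the other
  pairs, at most \<open>N\<^sup>2\<close> of them, the ratio
  \<open>\<delta> / \<theta> = N powr (1 / 24)\<close> makes the exceptional probability smaller
  than any power of \<open>N\<close>, while \<open>\<delta> * aN N\<close> still tends to
  \<open>0\<close>: the move is invisible on the scale \<open>1 / aN N\<close> of the points.
  Monotonicity of \<open>f\<close> stands in for continuity, which the cut at \<open>t\<close>
  excludes. It traps \<open>g\<close> between its values at the two ends of a window of half-width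
  \<open>\<delta>\<close>, and it makes \<open>g\<close> continuous almost everywhere, so that the
  difference of those values has expectation \<open>o(1 / N)\<close>.\<close>

lemma weighted_Levy_uniqueness:
  fixes X u :: "'a \<Rightarrow> real" and Y v :: "'b \<Rightarrow> real" and h :: "real \<Rightarrow> real"
  assumes A: "prob_space A" and B: "prob_space B"
    and [measurable]: "X \<in> borel_measurable A" "Y \<in> borel_measurable B"
      "u \<in> borel_measurable A" "v \<in> borel_measurable B" "h \<in> borel_measurable borel"
    and u: "\<And>x. 0 \<le> u x" "\<And>x. u x \<le> c" and v: "\<And>y. 0 \<le> v y" "\<And>y. v y \<le> c"
    and cos_eq: "\<And>t. (\<integral>x. u x * cos (t * X x) \<partial>A) = (\<integral>y. v y * cos (t * Y y) \<partial>B)"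
    and sin_eq: "\<And>t. (\<integral>x. u x * sin (t * X x) \<partial>A) = (\<integral>y. v y * sin (t * Y y) \<partial>B)"
  shows "(\<integral>x. u x * h (X x) \<partial>A) = (\<integral>y. v y * h (Y y) \<partial>B)"
proof -
  interpret A: prob_space A by fact
  interpret B: prob_space B by fact
  have iu[simp]: "integrable A u"
    by (rule A.integrable_const_bound[where B=c]) (use u in auto)
  have iv[simp]: "integrable B v"
    by (rule B.integrable_const_bound[where B=c]) (use v in auto)
  define m where "m = (\<integral>x. u x \<partial>A)"
  have m': "m = (\<integral>y. v y \<partial>B)"
    using cos_eq[of 0] by (simp add: m_def)
  have m0: "m \<ge> 0" unfolding m_def using u by simp
  show ?thesis
  proof (cases "m = 0")
    \<comment> \<open>A weight of total mass zero cannot be normalised, but then both weights vanish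
      almost everywhere.\<close>
    case True
    have "AE x in A. u x = 0"
      using integral_nonneg_eq_0_iff_AE[OF iu] u True by (simp add: m_def)
    then have "(\<integral>x. u x * h (X x) \<partial>A) = 0"
      by (intro integral_eq_zero_AE) auto
    moreover have "AE x in B. v x = 0"
      using integral_nonneg_eq_0_iff_AE[OF iv] v True m' by simp
    then have "(\<integral>x. v x * h (Y x) \<partial>B) = 0"
      by (intro integral_eq_zero_AE) auto
    ultimately show ?thesis by simp
  next
    case False
    with m0 have m: "m > 0" by simp
    \<comment> \<open>The laws of \<open>X\<close> and \<open>Y\<close> under the normalised
      weights. The same \<open>m\<close> serves both, by the cosine identity at
      \<open>t = 0\<close>; the cosine and sine identities then say that the real and imaginary
      parts of the characteristic functions agree.\<close>
    define D where "D = distr (density A (\<lambda>x. ennreal (u x / m))) borel X"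
    define E where "E = distr (density B (\<lambda>x. ennreal (v x / m))) borel Y"
    have "real_distribution D"
      unfolding D_def
    proof (rule prob_space.real_distribution_distr)
      have "(\<integral>\<^sup>+x. ennreal (u x / m) \<partial>A) = ennreal (\<integral>x. u x / m \<partial>A)"
        by (rule nn_integral_eq_integral) (use u m in auto)
      also have "\<dots> = 1" using m by (simp add: m_def[symmetric])
      finally show "prob_space (density A (\<lambda>x. ennreal (u x / m)))"
        by (intro prob_spaceI) (simp add: emeasure_density cong: nn_integral_cong)
    qed simp
    moreover have "real_distribution E"
      unfolding E_def
    proof (rule prob_space.real_distribution_distr)
      have "(\<integral>\<^sup>+x. ennreal (v x / m) \<partial>B) = ennreal (\<integral>x. v x / m \<partial>B)"
        by (rule nn_integral_eq_integral) (use v m in auto)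
      also have "\<dots> = 1" using m by (simp add: m'[symmetric])
      finally show "prob_space (density B (\<lambda>x. ennreal (v x / m)))"
        by (intro prob_spaceI) (simp add: emeasure_density cong: nn_integral_cong)
    qed simp
    moreover have "char D = char E"
    proof
      fix t
      have iD: "integrable A (\<lambda>x. (u x / m) *\<^sub>R iexp (t * X x))"
        by (rule Bochner_Integration.integrable_bound[where f="\<lambda>x. u x / m"])
           (use u m in \<open>auto simp: norm_mult\<close>)
      have iE: "integrable B (\<lambda>x. (v x / m) *\<^sub>R iexp (t * Y x))"
        by (rule Bochner_Integration.integrable_bound[where f="\<lambda>x. v x / m"])
           (use v m in \<open>auto simp: norm_mult\<close>)
      have D: "char D t = (\<integral>x. (u x / m) *\<^sub>R iexp (t * X x) \<partial>A)"
        unfolding D_def char_def using u m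
        by (subst integral_distr, simp, simp, subst integral_density) auto
      have E: "char E t = (\<integral>x. (v x / m) *\<^sub>R iexp (t * Y x) \<partial>B)"
        unfolding E_def char_def using v m
        by (subst integral_distr, simp, simp, subst integral_density) auto
      show "char D t = char E t"
      proof (rule complex_eqI)
        show "Re (char D t) = Re (char E t)"
          unfolding D E integral_Re[OF iD, symmetric] integral_Re[OF iE, symmetric]
          using cos_eq[of t] by (simp add: Re_exp)
        show "Im (char D t) = Im (char E t)"
          unfolding D E integral_Im[OF iD, symmetric] integral_Im[OF iE, symmetric]
          using sin_eq[of t] by (simp add: Im_exp)
      qed
    qed
    ultimately have "D = E" by (rule Levy_uniqueness)
    moreover have "(\<integral>z. h z \<partial>D) = (\<integral>x. u x * h (X x) \<partial>A) / m"
      unfolding D_def using u m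
      by (subst integral_distr, simp, simp, subst integral_density) auto
    moreover have "(\<integral>z. h z \<partial>E) = (\<integral>x. v x * h (Y x) \<partial>B) / m"
      unfolding E_def using v m
      by (subst integral_distr, simp, simp, subst integral_density) auto
    ultimately show ?thesis using m by (simp add: field_simps)
  qed
qed

text \<open>The weights \<open>U * (1 + cos \<dots>)\<close> are nonnegative, so they can be normalised to densities and
  Levy's theorem applies to them.\<close>

lemma cos_weighted_step:
  fixes X :: "'i \<Rightarrow> 'a \<Rightarrow> real" and Y :: "'i \<Rightarrow> 'b \<Rightarrow> real" and h :: "real \<Rightarrow> real"
    and U :: "'a \<Rightarrow> real" and U' :: "'b \<Rightarrow> real"
  assumes A: "prob_space A" and B: "prob_space B"
    and X[measurable]: "\<And>i. X i \<in> borel_measurable A" and Y[measurable]: "\<And>i. Y i \<in> borel_measurable B"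
    and [measurable]: "U \<in> borel_measurable A" "U' \<in> borel_measurable B" "h \<in> borel_measurable borel"
    and U: "\<And>x. 0 \<le> U x" "\<And>x. U x \<le> 1" and U': "\<And>y. 0 \<le> U' y" "\<And>y. U' y \<le> 1"
    and h: "\<And>x. 0 \<le> h x" "\<And>x. h x \<le> 1"
    and S: "finite S" "j \<in> S"
    and eq: "\<And>c \<alpha>. (\<integral>x. U x * cos ((\<Sum>i\<in>S. c i * X i x) + \<alpha>) \<partial>A) =
                   (\<integral>y. U' y * cos ((\<Sum>i\<in>S. c i * Y i y) + \<alpha>) \<partial>B)"
  shows "(\<integral>x. (U x * h (X j x)) * cos ((\<Sum>i\<in>S. c i * X i x) + \<alpha>) \<partial>A) =
         (\<integral>y. (U' y * h (Y j y)) * cos ((\<Sum>i\<in>S. c i * Y i y) + \<alpha>) \<partial>B)"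
proof -
  interpret A: prob_space A by fact
  interpret B: prob_space B by fact
  have int1: "integrable A (\<lambda>x. U x * k x)" if [measurable]: "k \<in> borel_measurable A" and k: "\<And>x. \<bar>k x\<bar> \<le> 1" for k
    by (rule A.integrable_const_bound[where B=1])
       (use U k in \<open>auto simp: abs_mult intro!: mult_le_one\<close>)
  have int2: "integrable B (\<lambda>x. U' x * k x)" if [measurable]: "k \<in> borel_measurable B" and k: "\<And>x. \<bar>k x\<bar> \<le> 1" for k
    by (rule B.integrable_const_bound[where B=1])
       (use U' k in \<open>auto simp: abs_mult intro!: mult_le_one\<close>)
  have upd: "(\<Sum>i\<in>S. (c(j := c j + t)) i * Z i) = (\<Sum>i\<in>S. c i * Z i) + t * Z j" for c :: "'i \<Rightarrow> real" and t Z
    using S by (simp add: sum.remove[of S j] algebra_simps)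
  have e1: "(\<integral>x. U x * cos (t * X j x + \<alpha>) \<partial>A) = (\<integral>y. U' y * cos (t * Y j y + \<alpha>) \<partial>B)" for t \<alpha>
    using eq[of "(\<lambda>_. 0)(j := 0 + t)" \<alpha>] unfolding upd[of "\<lambda>_. 0"] by simp
  have main: "(\<integral>x. (U x * (1 + cos ((\<Sum>i\<in>S. c i * X i x) + \<alpha>))) * h (X j x) \<partial>A) =
        (\<integral>x. (U' x * (1 + cos ((\<Sum>i\<in>S. c i * Y i x) + \<alpha>))) * h (Y j x) \<partial>B)" for \<alpha>
  proof (rule weighted_Levy_uniqueness[OF A B, where c=2 and X="X j" and Y="Y j" and h=h])
    \<comment> \<open>The product of two cosines is a sum of cosines in which only the coefficient
      of \<open>j\<close> has moved, by \<open>t\<close> or \<open>- t\<close>. Every term is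
      therefore an instance of \<open>eq\<close>. The phase \<open>\<beta>\<close> is there to turn
      the cosine into a sine below.\<close>
    have key: "(\<integral>x. (U x * (1 + cos ((\<Sum>i\<in>S. c i * X i x) + \<alpha>))) * cos (t * X j x + \<beta>) \<partial>A) =
        (\<integral>x. (U' x * (1 + cos ((\<Sum>i\<in>S. c i * Y i x) + \<alpha>))) * cos (t * Y j x + \<beta>) \<partial>B)" for t \<beta>
    proof -
      have id: "V * (1 + cos (s + \<alpha>)) * cos (z + \<beta>) =
         V * cos (z + \<beta>) + (V * cos (s + z + (\<alpha> + \<beta>)) / 2 + V * cos (s - z + (\<alpha> - \<beta>)) / 2)" for V s z :: real
        using cos_times_cos[of "s + \<alpha>" "z + \<beta>"] by (simp add: algebra_simps add_divide_distrib)
      have p: "(\<integral>x. U x * cos ((\<Sum>i\<in>S. c i * X i x) + t * X j x + \<gamma>) \<partial>A) =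
         (\<integral>y. U' y * cos ((\<Sum>i\<in>S. c i * Y i y) + t * Y j y + \<gamma>) \<partial>B)" for t \<gamma>
        using eq[of "c(j := c j + t)" \<gamma>] unfolding upd[of c t] .
      show ?thesis
        unfolding id using e1[of t \<beta>] p[of t "\<alpha> + \<beta>"] p[of "-t" "\<alpha> - \<beta>"]
        by (simp add: int1 int2)
    qed
    show "(\<integral>x. (U x * (1 + cos ((\<Sum>i\<in>S. c i * X i x) + \<alpha>))) * cos (t * X j x) \<partial>A) =
        (\<integral>x. (U' x * (1 + cos ((\<Sum>i\<in>S. c i * Y i x) + \<alpha>))) * cos (t * Y j x) \<partial>B)" for t
      using key[of t 0] by simp
    show "(\<integral>x. (U x * (1 + cos ((\<Sum>i\<in>S. c i * X i x) + \<alpha>))) * sin (t * X j x) \<partial>A) =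
        (\<integral>x. (U' x * (1 + cos ((\<Sum>i\<in>S. c i * Y i x) + \<alpha>))) * sin (t * Y j x) \<partial>B)" for t
    proof -
      have "cos (z + - (pi / 2)) = sin z" for z :: real
        unfolding cos_add by simp
      then show ?thesis using key[of t "- (pi / 2)"] by (simp only:)
    qed
    have b: "0 \<le> 1 + cos z" "1 + cos z \<le> 2" for z :: real
      using cos_ge_minus_one[of z] cos_le_one[of z] by linarith+
    show "0 \<le> U x * (1 + cos ((\<Sum>i\<in>S. c i * X i x) + \<alpha>))" for x
      using U b by (intro mult_nonneg_nonneg) auto
    show "0 \<le> U' x * (1 + cos ((\<Sum>i\<in>S. c i * Y i x) + \<alpha>))" for x
      using U' b by (intro mult_nonneg_nonneg) auto
    show "U x * (1 + cos ((\<Sum>i\<in>S. c i * X i x) + \<alpha>)) \<le> 2" for x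
      using mult_mono[OF U(2)[of x] b(2)[of "(\<Sum>i\<in>S. c i * X i x) + \<alpha>"]] b(1) by simp
    show "U' x * (1 + cos ((\<Sum>i\<in>S. c i * Y i x) + \<alpha>)) \<le> 2" for x
      using mult_mono[OF U'(2)[of x] b(2)[of "(\<Sum>i\<in>S. c i * Y i x) + \<alpha>"]] b(1) by simp
  qed measurable
  have split1: "(\<integral>x. (U x * (1 + cos ((\<Sum>i\<in>S. c i * X i x) + \<alpha>))) * h (X j x) \<partial>A) =
      (\<integral>x. U x * h (X j x) \<partial>A) + (\<integral>x. (U x * h (X j x)) * cos ((\<Sum>i\<in>S. c i * X i x) + \<alpha>) \<partial>A)" for \<alpha>
  proof -
    have "integrable A (\<lambda>x. U x * h (X j x))" "integrable A (\<lambda>x. U x * (h (X j x) * cos ((\<Sum>i\<in>S. c i * X i x) + \<alpha>)))"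
      by (rule int1; use h in \<open>auto simp: abs_mult intro!: mult_le_one\<close>)+
    then show ?thesis
      by (subst Bochner_Integration.integral_add[symmetric]) (auto simp: algebra_simps)
  qed
  have split2: "(\<integral>x. (U' x * (1 + cos ((\<Sum>i\<in>S. c i * Y i x) + \<alpha>))) * h (Y j x) \<partial>B) =
      (\<integral>x. U' x * h (Y j x) \<partial>B) + (\<integral>x. (U' x * h (Y j x)) * cos ((\<Sum>i\<in>S. c i * Y i x) + \<alpha>) \<partial>B)" for \<alpha>
  proof -
    have "integrable B (\<lambda>x. U' x * h (Y j x))" "integrable B (\<lambda>x. U' x * (h (Y j x) * cos ((\<Sum>i\<in>S. c i * Y i x) + \<alpha>)))"
      by (rule int2; use h in \<open>auto simp: abs_mult intro!: mult_le_one\<close>)+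
    then show ?thesis
      by (subst Bochner_Integration.integral_add[symmetric]) (auto simp: algebra_simps)
  qed
  \<comment> \<open>Passing from \<open>\<alpha>\<close> to \<open>\<alpha> + pi\<close> flips the
    sign of the cosine term, so subtracting the two instances of \<open>main\<close> removes the
    constant part of the weight.\<close>
  have shift: "cos (z + (\<alpha> + pi)) = - cos (z + \<alpha>)" for z
    by (simp add: add.assoc[symmetric])
  show ?thesis
    using main[of \<alpha>, unfolded split1 split2] main[of "\<alpha> + pi", unfolded split1 split2, unfolded shift]
    by simp
qed

text \<open>A form of the uniqueness theorem for joint characteristic functions that needs no
  measure on a product space: one coordinate at a time is moved out of the exponent.\<close>

lemma prod_expectation_eq_if_char_eq:
  fixes X :: "'i \<Rightarrow> 'a \<Rightarrow> real" and Y :: "'i \<Rightarrow> 'b \<Rightarrow> real" and h :: "'i \<Rightarrow> real \<Rightarrow> real"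
  assumes A: "prob_space A" and B: "prob_space B"
    and X[measurable]: "\<And>i. X i \<in> borel_measurable A" and Y[measurable]: "\<And>i. Y i \<in> borel_measurable B"
    and h[measurable]: "\<And>i. h i \<in> borel_measurable borel"
    and h01: "\<And>i x. 0 \<le> h i x" "\<And>i x. h i x \<le> 1"
    and S: "finite S"
    and eq: "\<And>c \<alpha>. (\<integral>x. cos ((\<Sum>i\<in>S. c i * X i x) + \<alpha>) \<partial>A) =
                   (\<integral>y. cos ((\<Sum>i\<in>S. c i * Y i y) + \<alpha>) \<partial>B)"
  shows "(\<integral>x. (\<Prod>i\<in>S. h i (X i x)) \<partial>A) = (\<integral>y. (\<Prod>i\<in>S. h i (Y i y)) \<partial>B)"
proof -
  \<comment> \<open>The exponent runs over all of \<open>S\<close> with arbitrary coefficients while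
    \<open>J\<close> grows, so the induction hypothesis is exactly what
    \<open>cos_weighted_step\<close> asks of the weight. Zero coefficients at the end leave the bare
    product.\<close>
  have *: "(\<integral>x. (\<Prod>i\<in>J. h i (X i x)) * cos ((\<Sum>i\<in>S. c i * X i x) + \<alpha>) \<partial>A) =
        (\<integral>y. (\<Prod>i\<in>J. h i (Y i y)) * cos ((\<Sum>i\<in>S. c i * Y i y) + \<alpha>) \<partial>B)"
    if "finite J" "J \<subseteq> S" for J c \<alpha>
    using that
  proof (induction J arbitrary: c \<alpha> rule: finite_induct)
    case empty
    then show ?case using eq by simp
  next
    case (insert j J)
    have "(\<integral>x. ((\<Prod>i\<in>J. h i (X i x)) * h j (X j x)) * cos ((\<Sum>i\<in>S. c i * X i x) + \<alpha>) \<partial>A) =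
        (\<integral>y. ((\<Prod>i\<in>J. h i (Y i y)) * h j (Y j y)) * cos ((\<Sum>i\<in>S. c i * Y i y) + \<alpha>) \<partial>B)"
      using insert
      by (intro cos_weighted_step[OF A B]) (auto simp: S h01 intro!: prod_nonneg prod_le_1)
    then show ?case using insert by (simp add: mult.commute)
  qed
  show ?thesis using *[of S "\<lambda>_. 0" 0] S by simp
qed

section \<open>Gaussian fields\<close>

lemma std_normal_cos:
  "(\<integral>z. cos (b * z + \<alpha>) \<partial>std_normal_distribution) = cos \<alpha> * exp (- b\<^sup>2 / 2)"
proof -
  interpret real_distribution std_normal_distribution by (rule real_dist_normal_dist)
  have i: "integrable std_normal_distribution (\<lambda>z. iexp (b * z))"
    by (rule integrable_const_bound[where B=1]) auto
  have c: "(\<integral>z. cos (b * z) \<partial>std_normal_distribution) = exp (- b\<^sup>2 / 2)"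
    using arg_cong[OF char_std_normal_distribution, of "\<lambda>f. Re (f b)"] integral_Re[OF i]
    unfolding char_def by (simp add: Re_exp)
  have s: "(\<integral>z. sin (b * z) \<partial>std_normal_distribution) = 0"
    using arg_cong[OF char_std_normal_distribution, of "\<lambda>f. Im (f b)"] integral_Im[OF i]
    unfolding char_def by (simp add: Im_exp)
  have "integrable std_normal_distribution (\<lambda>z. cos (b * z))"
    "integrable std_normal_distribution (\<lambda>z. sin (b * z))"
    by (rule integrable_const_bound[where B=1]; simp)+
  then show ?thesis
    by (simp add: cos_add c s)
qed

lemma std_normal_integral_density:
  fixes f :: "real \<Rightarrow> real"
  assumes [measurable]: "f \<in> borel_measurable borel"
  shows "(\<integral>z. f z \<partial>std_normal_distribution) = (\<integral>z. std_normal_density z * f z \<partial>lborel)"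
  by (subst integral_density) auto

text \<open>For \<open>z \<ge> u \<ge> 0\<close> one has
  \<open>z\<^sup>2 \<ge> u\<^sup>2 + (z - u)\<^sup>2\<close>, so the density at \<open>z\<close> is
  at most \<open>exp (- u\<^sup>2 / 2)\<close> times the density shifted by \<open>u\<close>, which
  integrates to one.\<close>

lemma std_normal_tail_le:
  assumes "0 \<le> u"
  shows "measure std_normal_distribution {u..} \<le> exp (- u\<^sup>2 / 2)"
proof -
  interpret real_distribution std_normal_distribution by (rule real_dist_normal_dist)
  have i: "integrable lborel std_normal_density" by simp
  have iu: "integrable lborel (\<lambda>z. std_normal_density (- u + 1 * z))"
    by (rule lborel_integrable_real_affine[OF i]) simp
  have "measure std_normal_distribution {u..} = (\<integral>z. std_normal_density z * indicator {u..} z \<partial>lborel)"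
    using std_normal_integral_density[of "indicator {u..}"] by simp
  also have "\<dots> \<le> (\<integral>z. exp (- u\<^sup>2 / 2) * std_normal_density (- u + 1 * z) \<partial>lborel)"
  proof (rule integral_mono)
    show "integrable lborel (\<lambda>z. std_normal_density z * indicator {u..} z)"
      by (rule Bochner_Integration.integrable_bound[OF i]) (auto split: split_indicator)
    show "integrable lborel (\<lambda>z. exp (- u\<^sup>2 / 2) * std_normal_density (- u + 1 * z))"
      using iu by (rule integrable_mult_right)
    fix z
    show "std_normal_density z * indicator {u..} z \<le> exp (- u\<^sup>2 / 2) * std_normal_density (- u + 1 * z)"
    proof (cases "z \<ge> u")
      case True
      then have "0 \<le> u * (z - u)" using assms by simp
      then have "- z\<^sup>2 / 2 \<le> - u\<^sup>2 / 2 + - (- u + 1 * z)\<^sup>2 / 2"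
        by (simp add: power2_eq_square algebra_simps)
      then have "exp (- z\<^sup>2 / 2) \<le> exp (- u\<^sup>2 / 2) * exp (- (- u + 1 * z)\<^sup>2 / 2)"
        unfolding exp_add[symmetric] by simp
      then show ?thesis using True
        by (simp add: std_normal_density_def divide_right_mono)
    qed simp
  qed
  also have "\<dots> = exp (- u\<^sup>2 / 2) * (\<integral>z. std_normal_density z \<partial>lborel)"
    using lborel_integral_real_affine[of 1 std_normal_density "- u"] by simp
  also have "\<dots> = exp (- u\<^sup>2 / 2)" by simp
  finally show ?thesis .
qed

text \<open>The assumption \<open>cos_field\<close> is the joint characteristic function in real
  form: the phases \<open>0\<close> and \<open>- pi / 2\<close> recover the cosine and the sine
  part. This is the shape in which the uniqueness theorem for products takes its input, and
  \<open>rho\<close> is the correlation, all variances being one.\<close>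

locale gaussian_field = prob_space M for M :: "'a measure" +
  fixes Z :: "'v \<Rightarrow> 'a \<Rightarrow> real" and rho :: "'v \<Rightarrow> 'v \<Rightarrow> real"
  assumes Z_measurable[measurable]: "Z x \<in> borel_measurable M"
    and rho_refl: "rho x x = 1"
    and rho_sym: "rho x y = rho y x"
    and rho_nonneg: "0 \<le> rho x y"
    and cos_field: "finite S \<Longrightarrow> (\<integral>\<omega>. cos ((\<Sum>x\<in>S. c x * Z x \<omega>) + \<alpha>) \<partial>M) =
      cos \<alpha> * exp (- (\<Sum>x\<in>S. \<Sum>y\<in>S. c x * c y * rho x y) / 2)"
begin

abbreviation "N01 \<equiv> std_normal_distribution"

sublocale N: real_distribution N01 by (rule real_dist_normal_dist)
sublocale P: pair_prob_space M N01 ..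

lemma law_linear_combination:
  fixes h :: "real \<Rightarrow> real"
  assumes S: "finite S" and v: "(\<Sum>x\<in>S. \<Sum>y\<in>S. c x * c y * rho x y) = v\<^sup>2"
    and [measurable]: "h \<in> borel_measurable borel" and h: "\<And>x. 0 \<le> h x" "\<And>x. h x \<le> 1"
  shows "(\<integral>\<omega>. h (\<Sum>x\<in>S. c x * Z x \<omega>) \<partial>M) = (\<integral>z. h (v * z) \<partial>N01)"
proof -
  \<comment> \<open>The uniqueness theorem over a one-point index set. Only \<open>v\<^sup>2\<close>
    enters the characteristic function, so either sign of \<open>v\<close> is allowed.\<close>
  have "(\<integral>\<omega>. (\<Prod>i\<in>{()}. h (\<Sum>x\<in>S. c x * Z x \<omega>)) \<partial>M) = (\<integral>z. (\<Prod>i\<in>{()}. h (v * z)) \<partial>N01)"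
  proof (rule prod_expectation_eq_if_char_eq[OF prob_space_axioms N.prob_space_axioms,
      where X="\<lambda>_ \<omega>. \<Sum>x\<in>S. c x * Z x \<omega>" and Y="\<lambda>_ z. v * z" and h="\<lambda>_. h"])
    fix d :: "unit \<Rightarrow> real" and \<alpha>
    have "(\<integral>\<omega>. cos ((\<Sum>x\<in>S. (d () * c x) * Z x \<omega>) + \<alpha>) \<partial>M) =
        cos \<alpha> * exp (- (\<Sum>x\<in>S. \<Sum>y\<in>S. (d () * c x) * (d () * c y) * rho x y) / 2)"
      by (rule cos_field[OF S])
    also have "(\<Sum>x\<in>S. \<Sum>y\<in>S. (d () * c x) * (d () * c y) * rho x y) = (d () * v)\<^sup>2"
      unfolding power_mult_distrib v[symmetric]
      by (simp add: sum_distrib_left power2_eq_square mult_ac)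
    also have "cos \<alpha> * exp (- (d () * v)\<^sup>2 / 2) = (\<integral>z. cos ((d () * v) * z + \<alpha>) \<partial>N01)"
      by (simp only: std_normal_cos)
    finally show "(\<integral>\<omega>. cos ((\<Sum>i\<in>{()}. d i * (\<Sum>x\<in>S. c x * Z x \<omega>)) + \<alpha>) \<partial>M) =
        (\<integral>z. cos ((\<Sum>i\<in>{()}. d i * (v * z)) + \<alpha>) \<partial>N01)"
      by (simp add: sum_distrib_left mult.assoc)
  qed (use h in auto)
  then show ?thesis by simp
qed

lemma law_coordinate:
  fixes h :: "real \<Rightarrow> real"
  assumes "h \<in> borel_measurable borel" "\<And>x. 0 \<le> h x" "\<And>x. h x \<le> 1"
  shows "(\<integral>\<omega>. h (Z k \<omega>) \<partial>M) = (\<integral>z. h z \<partial>N01)"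
  using law_linear_combination[of "{k}" "\<lambda>_. 1" 1 h] assms by (simp add: rho_refl)

lemma integral_pair_eq_iterated:
  fixes f :: "'a \<times> real \<Rightarrow> real"
  assumes [measurable]: "f \<in> borel_measurable (M \<Otimes>\<^sub>M N01)" and "\<And>w. \<bar>f w\<bar> \<le> C"
  shows "(\<integral>w. f w \<partial>(M \<Otimes>\<^sub>M N01)) = (\<integral>\<omega>. (\<integral>z. f (\<omega>, z) \<partial>N01) \<partial>M)"
proof -
  have "integrable (M \<Otimes>\<^sub>M N01) f"
    by (rule P.integrable_const_bound[where B=C]) (use assms in auto)
  then show ?thesis by (simp add: P.integral_fst')
qed

text \<open>Integrating over the independent coordinate first, with the field absorbed into the
  phase, adds \<open>b\<^sup>2\<close> to the variance.\<close>

lemma cos_pair: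
  assumes S: "finite S"
  shows "(\<integral>w. cos ((\<Sum>x\<in>S. c x * Z x (fst w)) + b * snd w + \<alpha>) \<partial>(M \<Otimes>\<^sub>M N01)) =
    cos \<alpha> * exp (- ((\<Sum>x\<in>S. \<Sum>y\<in>S. c x * c y * rho x y) + b\<^sup>2) / 2)"
proof -
  have "(\<integral>w. cos ((\<Sum>x\<in>S. c x * Z x (fst w)) + b * snd w + \<alpha>) \<partial>(M \<Otimes>\<^sub>M N01)) =
     (\<integral>\<omega>. (\<integral>z. cos (b * z + ((\<Sum>x\<in>S. c x * Z x \<omega>) + \<alpha>)) \<partial>N01) \<partial>M)"
    by (subst integral_pair_eq_iterated[where C=1]) (auto simp: add_ac)
  also have "\<dots> = (\<integral>\<omega>. cos ((\<Sum>x\<in>S. c x * Z x \<omega>) + \<alpha>) * exp (- b\<^sup>2 / 2) \<partial>M)"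
    unfolding std_normal_cos ..
  also have "\<dots> = cos \<alpha> * exp (- (\<Sum>x\<in>S. \<Sum>y\<in>S. c x * c y * rho x y) / 2) * exp (- b\<^sup>2 / 2)"
    using cos_field[OF S] by simp
  also have "\<dots> = cos \<alpha> * exp (- ((\<Sum>x\<in>S. \<Sum>y\<in>S. c x * c y * rho x y) + b\<^sup>2) / 2)"
    by (simp add: exp_add[symmetric] add_divide_distrib diff_divide_distrib)
  finally show ?thesis .
qed

lemma quadratic_form_insert:
  assumes "finite S" "k \<notin> S"
  shows "(\<Sum>x\<in>insert k S. \<Sum>y\<in>insert k S. c x * c y * rho x y) =
    (\<Sum>x\<in>S. \<Sum>y\<in>S. c x * c y * rho x y) + 2 * c k * (\<Sum>x\<in>S. c x * rho x k) + (c k)\<^sup>2"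
proof -
  have "(\<Sum>y\<in>S. c k * c y * rho k y) = c k * (\<Sum>x\<in>S. c x * rho x k)"
    by (simp add: sum_distrib_left rho_sym[of k] mult_ac)
  moreover have "(\<Sum>x\<in>S. c x * c k * rho x k) = c k * (\<Sum>x\<in>S. c x * rho x k)"
    by (simp add: sum_distrib_left mult_ac)
  ultimately show ?thesis
    using assms by (simp add: sum.distrib rho_refl power2_eq_square)
qed

text \<open>The value of the field at \<open>k\<close> is replaced by an independent copy \<open>z\<close>; the other
  values follow along their regression on it, so that they become independent of \<open>Z k\<close>.\<close>

definition resampled :: "'v \<Rightarrow> 'v \<Rightarrow> 'a \<times> real \<Rightarrow> real" where
  "resampled k x w = Z x (fst w) + rho x k * (snd w - Z k (fst w))"

lemma resampled_measurable[measurable]: "resampled k x \<in> borel_measurable (M \<Otimes>\<^sub>M N01)"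
  unfolding resampled_def by measurable

text \<open>Subtracting \<open>rho i k * Z k\<close> makes the values uncorrelated with
  \<open>Z k\<close>, and adding \<open>rho i k * z\<close> restores their covariances. Hence
  \<open>Z k\<close> together with the resampled values has the joint law of \<open>z\<close>
  together with the original ones.\<close>

lemma resampled_independent:
  fixes g :: "real \<Rightarrow> real" and h :: "'v \<Rightarrow> real \<Rightarrow> real"
  assumes S: "finite S" "k \<notin> S"
    and g[measurable]: "g \<in> borel_measurable borel" and g01: "\<And>x. 0 \<le> g x" "\<And>x. g x \<le> 1"
    and h[measurable]: "\<And>i. h i \<in> borel_measurable borel"
    and h01: "\<And>i x. 0 \<le> h i x" "\<And>i x. h i x \<le> 1"
  shows "(\<integral>w. g (Z k (fst w)) * (\<Prod>i\<in>S. h i (resampled k i w)) \<partial>(M \<Otimes>\<^sub>M N01)) =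
    (\<integral>z. g z \<partial>N01) * (\<integral>\<omega>. (\<Prod>i\<in>S. h i (Z i \<omega>)) \<partial>M)"
proof -
  define X where "X i w = (if i = k then Z k (fst w) else resampled k i w)" for i w
  define Y where "Y i w = (if i = k then snd w else Z i (fst w))" for i and w :: "'a \<times> real"
  define h' where "h' i = (if i = k then g else h i)" for i
  have ins: "(\<Prod>i\<in>insert k S. h' i (V i)) = g (V k) * (\<Prod>i\<in>S. h i (V i))" for V
    using S by (auto simp: h'_def intro!: prod.cong)
  have "(\<integral>w. (\<Prod>i\<in>insert k S. h' i (X i w)) \<partial>(M \<Otimes>\<^sub>M N01)) =
     (\<integral>w. (\<Prod>i\<in>insert k S. h' i (Y i w)) \<partial>(M \<Otimes>\<^sub>M N01))"
  proof (rule prod_expectation_eq_if_char_eq[OF P.prob_space_axioms P.prob_space_axioms,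
      where X=X and Y=Y and h=h'])
    show "X i \<in> borel_measurable (M \<Otimes>\<^sub>M N01)" for i
      unfolding X_def by measurable
    show "Y i \<in> borel_measurable (M \<Otimes>\<^sub>M N01)" for i
      unfolding Y_def by measurable
    show "h' i \<in> borel_measurable borel" "0 \<le> h' i x" "h' i x \<le> 1" for i x
      unfolding h'_def using g01 h01 by auto
    show "finite (insert k S)" using S by simp
    fix c \<alpha>
    let ?A = "\<Sum>i\<in>S. c i * rho i k"
    let ?Q = "\<Sum>x\<in>S. \<Sum>y\<in>S. c x * c y * rho x y"
    let ?c = "c(k := c k - ?A)"
    have Seq: "(\<Sum>x\<in>S. ?c x * V x) = (\<Sum>x\<in>S. c x * V x)" for V
      using S by (intro sum.cong) auto
    have Qeq: "(\<Sum>x\<in>S. \<Sum>y\<in>S. ?c x * ?c y * rho x y) = ?Q"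
      using S by (intro sum.cong) auto
    have X: "(\<Sum>i\<in>insert k S. c i * X i w) = (\<Sum>i\<in>insert k S. ?c i * Z i (fst w)) + ?A * snd w" for w
    proof -
      have "(\<Sum>i\<in>S. c i * X i w) = (\<Sum>i\<in>S. c i * Z i (fst w) + (c i * rho i k) * (snd w - Z k (fst w)))"
        using S by (intro sum.cong) (auto simp: X_def resampled_def algebra_simps)
      also have "\<dots> = (\<Sum>i\<in>S. c i * Z i (fst w)) + ?A * (snd w - Z k (fst w))"
        by (simp add: sum.distrib sum_distrib_right)
      finally have "(\<Sum>i\<in>S. c i * X i w) = (\<Sum>i\<in>S. c i * Z i (fst w)) + ?A * (snd w - Z k (fst w))" .
      then show ?thesis
        unfolding sum.insert[OF S] Seq by (simp add: X_def algebra_simps)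
    qed
    have Y: "(\<Sum>i\<in>insert k S. c i * Y i w) = (\<Sum>i\<in>S. c i * Z i (fst w)) + c k * snd w" for w
    proof -
      have "(\<Sum>i\<in>S. c i * Y i w) = (\<Sum>i\<in>S. c i * Z i (fst w))"
        using S by (intro sum.cong) (auto simp: Y_def)
      then show ?thesis using S by (simp add: Y_def)
    qed
    \<comment> \<open>A square is completed: \<open>2 * (c k - A) * A + (c k - A)\<^sup>2 +
      A\<^sup>2 = (c k)\<^sup>2\<close>, where \<open>A\<close> is the coefficient that the
      resampling gives to the new variable and takes from \<open>Z k\<close>.\<close>
    have "(\<Sum>x\<in>insert k S. \<Sum>y\<in>insert k S. ?c x * ?c y * rho x y) + ?A\<^sup>2 = ?Q + (c k)\<^sup>2"
      unfolding quadratic_form_insert[OF S] Qeq Seq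
      by (simp add: power2_eq_square algebra_simps)
    then show "(\<integral>w. cos ((\<Sum>i\<in>insert k S. c i * X i w) + \<alpha>) \<partial>(M \<Otimes>\<^sub>M N01)) =
        (\<integral>w. cos ((\<Sum>i\<in>insert k S. c i * Y i w) + \<alpha>) \<partial>(M \<Otimes>\<^sub>M N01))"
      unfolding X Y cos_pair[OF finite.insertI[OF S(1)]] cos_pair[OF S(1)] by (simp only:)
  qed
  then have "(\<integral>w. g (X k w) * (\<Prod>i\<in>S. h i (X i w)) \<partial>(M \<Otimes>\<^sub>M N01)) =
     (\<integral>w. g (Y k w) * (\<Prod>i\<in>S. h i (Y i w)) \<partial>(M \<Otimes>\<^sub>M N01))"
    unfolding ins .
  moreover have "g (X k w) * (\<Prod>i\<in>S. h i (X i w)) = g (Z k (fst w)) * (\<Prod>i\<in>S. h i (resampled k i w))" for w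
  proof -
    have "(\<Prod>i\<in>S. h i (X i w)) = (\<Prod>i\<in>S. h i (resampled k i w))"
      using S by (intro prod.cong) (auto simp: X_def)
    then show ?thesis by (simp add: X_def)
  qed
  moreover have "g (Y k w) * (\<Prod>i\<in>S. h i (Y i w)) = g (snd w) * (\<Prod>i\<in>S. h i (Z i (fst w)))" for w
  proof -
    have "(\<Prod>i\<in>S. h i (Y i w)) = (\<Prod>i\<in>S. h i (Z i (fst w)))"
      using S by (intro prod.cong) (auto simp: Y_def)
    then show ?thesis by (simp add: Y_def)
  qed
  moreover have "(\<integral>w. g (snd w) * (\<Prod>i\<in>S. h i (Z i (fst w))) \<partial>(M \<Otimes>\<^sub>M N01)) =
     (\<integral>z. g z \<partial>N01) * (\<integral>\<omega>. (\<Prod>i\<in>S. h i (Z i \<omega>)) \<partial>M)"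
  proof (subst integral_pair_eq_iterated[where C=1])
    show "\<bar>g (snd w) * (\<Prod>i\<in>S. h i (Z i (fst w)))\<bar> \<le> 1" for w
      using g01 h01 by (auto simp: abs_mult abs_prod intro!: mult_le_one prod_nonneg prod_le_1)
  qed simp_all
  ultimately show ?thesis by simp
qed

end

section \<open>Covariance estimates from resampling one vertex\<close>

context gaussian_field begin

lemma std_normal_two_sided_tail_le:
  assumes "0 \<le> t"
  shows "measure N01 {z. t \<le> \<bar>z\<bar>} \<le> 2 * exp (- t\<^sup>2 / 2)"
proof -
  have "measure N01 {z. t \<le> - z} = measure N01 {t..}"
  proof -
    \<comment> \<open>the symmetry of \<open>N01\<close>: both \<open>1\<close> and \<open>-1\<close> are square roots of the variance of one coordinate\<close>
    have "(\<integral>z. indicator {t..} (- 1 * z) \<partial>N01) = (\<integral>z. indicator {t..} (1 * z) \<partial>N01 :: real)"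
      using law_linear_combination[of "{undefined}" "\<lambda>_. 1" "- 1" "indicator {t..}"]
        law_linear_combination[of "{undefined}" "\<lambda>_. 1" 1 "indicator {t..}"]
      by (simp add: rho_refl)
    moreover have "(\<integral>z. indicator {t..} (- 1 * z) \<partial>N01) = (\<integral>z. indicator {z. t \<le> - z} z \<partial>N01 :: real)"
      by (intro Bochner_Integration.integral_cong) (auto split: split_indicator)
    ultimately show ?thesis by simp
  qed
  moreover have "measure N01 {z. t \<le> \<bar>z\<bar>} \<le> measure N01 ({t..} \<union> {z. t \<le> - z})"
    by (rule N.finite_measure_mono) auto
  moreover have "\<dots> \<le> measure N01 {t..} + measure N01 {z. t \<le> - z}"
    by (rule measure_Un_le) auto
  ultimately show ?thesis using std_normal_tail_le[OF assms] by simp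
qed

text \<open>The absolute difference is at most the sum of its terms. The resampled term is
  independent of \<open>Z k\<close> and gives the square. The other needs both values to be at least
  \<open>u\<close>, hence a sum of at least \<open>2 * u\<close>, and this sum is normal with
  variance \<open>2 + 2 * rho i k \<le> 3\<close>.\<close>

lemma near_pair_bound:
  fixes g :: "real \<Rightarrow> real"
  assumes ik: "i \<noteq> k" and r: "rho i k \<le> 1 / 2"
    and g[measurable]: "g \<in> borel_measurable borel" and g01: "\<And>x. 0 \<le> g x" "\<And>x. g x \<le> 1"
    and u: "0 \<le> u" "\<And>z. z < u \<Longrightarrow> g z = 0"
  shows "(\<integral>w. g (Z k (fst w)) * \<bar>g (Z i (fst w)) - g (resampled k i w)\<bar> \<partial>(M \<Otimes>\<^sub>M N01))
    \<le> exp (- 2 * u\<^sup>2 / 3) + (\<integral>z. g z \<partial>N01)\<^sup>2"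
proof -
  have int: "integrable (M \<Otimes>\<^sub>M N01) h" if [measurable]: "h \<in> borel_measurable (M \<Otimes>\<^sub>M N01)" and "\<And>w. \<bar>h w\<bar> \<le> 1" for h :: "_ \<Rightarrow> real"
    by (rule P.integrable_const_bound[where B=1]) (use that in auto)
  have gg: "\<bar>g a * g b\<bar> \<le> 1" for a b
    using g01 by (simp add: abs_mult mult_le_one)
  have gd: "\<bar>g a * \<bar>g b - g c\<bar>\<bar> \<le> 1" for a b c
  proof -
    have "\<bar>g b - g c\<bar> \<le> 1" using g01(1)[of b] g01(1)[of c] g01(2)[of b] g01(2)[of c] by linarith
    then show ?thesis using g01 by (simp add: abs_mult mult_le_one)
  qed
  have "(\<integral>w. g (Z k (fst w)) * \<bar>g (Z i (fst w)) - g (resampled k i w)\<bar> \<partial>(M \<Otimes>\<^sub>M N01)) \<le>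
      (\<integral>w. g (Z k (fst w)) * g (Z i (fst w)) + g (Z k (fst w)) * g (resampled k i w) \<partial>(M \<Otimes>\<^sub>M N01))"
  proof (rule integral_mono)
    show "g (Z k (fst w)) * \<bar>g (Z i (fst w)) - g (resampled k i w)\<bar> \<le>
        g (Z k (fst w)) * g (Z i (fst w)) + g (Z k (fst w)) * g (resampled k i w)" for w
    proof -
      have "\<bar>g (Z i (fst w)) - g (resampled k i w)\<bar> \<le> g (Z i (fst w)) + g (resampled k i w)"
        using g01(1)[of "Z i (fst w)"] g01(1)[of "resampled k i w"] by linarith
      from mult_left_mono[OF this g01(1)] show ?thesis by (simp add: distrib_left)
    qed
  qed (intro Bochner_Integration.integrable_add int gg gd; measurable)+
  also have "\<dots> = (\<integral>w. g (Z k (fst w)) * g (Z i (fst w)) \<partial>(M \<Otimes>\<^sub>M N01)) +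
      (\<integral>w. g (Z k (fst w)) * g (resampled k i w) \<partial>(M \<Otimes>\<^sub>M N01))"
    by (intro Bochner_Integration.integral_add int gg) measurable
  also have "(\<integral>w. g (Z k (fst w)) * g (resampled k i w) \<partial>(M \<Otimes>\<^sub>M N01)) = (\<integral>z. g z \<partial>N01)\<^sup>2"
    using resampled_independent[of "{i}" k g "\<lambda>_. g"] ik g01
    by (simp add: law_coordinate power2_eq_square)
  also have "(\<integral>w. g (Z k (fst w)) * g (Z i (fst w)) \<partial>(M \<Otimes>\<^sub>M N01)) = (\<integral>\<omega>. g (Z k \<omega>) * g (Z i \<omega>) \<partial>M)"
    using integral_pair_eq_iterated[of "\<lambda>w. g (Z k (fst w)) * g (Z i (fst w))" 1] gg N.prob_space by simp
  also have "(\<integral>\<omega>. g (Z k \<omega>) * g (Z i \<omega>) \<partial>M) \<le> (\<integral>\<omega>. indicator {2 * u..} (\<Sum>x\<in>{k, i}. 1 * Z x \<omega>) \<partial>M)"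
  proof (rule integral_mono)
    show "integrable M (\<lambda>\<omega>. g (Z k \<omega>) * g (Z i \<omega>))"
      by (rule integrable_const_bound[where B=1]) (use gg in auto)
    show "integrable M (\<lambda>\<omega>. indicator {2 * u..} (\<Sum>x\<in>{k, i}. 1 * Z x \<omega>) :: real)"
      by (rule integrable_const_bound[where B=1]) auto
    fix \<omega>
    show "g (Z k \<omega>) * g (Z i \<omega>) \<le> indicator {2 * u..} (\<Sum>x\<in>{k, i}. 1 * Z x \<omega>)"
    proof (cases "Z k \<omega> < u \<or> Z i \<omega> < u")
      case True
      then have "g (Z k \<omega>) * g (Z i \<omega>) = 0" using u by auto
      then show ?thesis by (simp only: indicator_pos_le)
    next
      case False
      then show ?thesis using gg[of "Z k \<omega>" "Z i \<omega>"] ik by (auto simp: indicator_def)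
    qed
  qed
  also have "\<dots> = (\<integral>z. indicator {2 * u..} (sqrt (2 + 2 * rho i k) * z) \<partial>N01)"
    using ik rho_nonneg[of i k] rho_sym[of k i]
    by (intro law_linear_combination) (auto simp: rho_refl)
  also have "\<dots> \<le> (\<integral>z. indicator {2 * u / sqrt 3..} z \<partial>N01)"
  proof (rule integral_mono)
    fix z :: real
    show "indicator {2 * u..} (sqrt (2 + 2 * rho i k) * z) \<le> (indicator {2 * u / sqrt 3..} z :: real)"
    proof (cases "2 * u \<le> sqrt (2 + 2 * rho i k) * z")
      case True
      \<comment> \<open>As \<open>0 \<le> u\<close>, the event forces \<open>z \<ge> 0\<close>; only
        then does enlarging the factor to \<open>sqrt 3\<close> enlarge the event.\<close>
      have pos: "0 < sqrt (2 + 2 * rho i k)" using rho_nonneg[of i k] by simp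
      have "0 \<le> sqrt (2 + 2 * rho i k) * z" using True u(1) by linarith
      with pos have "0 \<le> z" by (simp add: zero_le_mult_iff)
      then have "sqrt (2 + 2 * rho i k) * z \<le> sqrt 3 * z"
        using r by (intro mult_right_mono) auto
      then have "2 * u / sqrt 3 \<le> z" using True by (simp add: field_simps)
      then show ?thesis by (simp add: indicator_def)
    qed (simp add: indicator_def)
  qed (rule N.integrable_const_bound[where B=1]; simp)+
  also have "\<dots> = measure N01 {2 * u / sqrt 3..}" by simp
  also have "\<dots> \<le> exp (- (2 * u / sqrt 3)\<^sup>2 / 2)"
    using u(1) by (intro std_normal_tail_le) simp
  also have "- (2 * u / sqrt 3)\<^sup>2 / 2 = - 2 * u\<^sup>2 / 3"
    by (simp add: power_divide power_mult_distrib)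
  finally show ?thesis by simp
qed

text \<open>The window is centred at the resampled value and not at \<open>Z i\<close>: the bound on
  the difference is then a function of a variable independent of \<open>Z k\<close>, so the
  expectation factorises.\<close>

lemma far_pair_bound:
  fixes g :: "real \<Rightarrow> real"
  assumes ik: "i \<noteq> k" and r: "rho i k \<le> \<theta>" and \<theta>: "0 < \<theta>" and \<delta>: "0 < \<delta>"
    and mono: "mono g" and g01: "\<And>x. 0 \<le> g x" "\<And>x. g x \<le> 1"
  shows "(\<integral>w. g (Z k (fst w)) * \<bar>g (Z i (fst w)) - g (resampled k i w)\<bar> \<partial>(M \<Otimes>\<^sub>M N01))
    \<le> (\<integral>z. g z \<partial>N01) * (\<integral>z. g (z + \<delta>) - g (z - \<delta>) \<partial>N01) + 4 * exp (- \<delta>\<^sup>2 / (8 * \<theta>\<^sup>2))"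
proof -
  have g[measurable]: "g \<in> borel_measurable borel" using mono by (rule borel_measurable_mono)
  have int: "integrable (M \<Otimes>\<^sub>M N01) h" if [measurable]: "h \<in> borel_measurable (M \<Otimes>\<^sub>M N01)" and "\<And>w. \<bar>h w\<bar> \<le> 1" for h :: "_ \<Rightarrow> real"
    by (rule P.integrable_const_bound[where B=1]) (use that in auto)
  define h where "h z = g (z + \<delta>) - g (z - \<delta>)" for z
  have [measurable]: "h \<in> borel_measurable borel" unfolding h_def by measurable
  have h01: "0 \<le> h z" "h z \<le> 1" for z
    using monoD[OF mono, of "z - \<delta>" "z + \<delta>"] \<delta> g01(1)[of "z - \<delta>"] g01(2)[of "z + \<delta>"]
    unfolding h_def by auto
  \<comment> \<open>While \<open>\<bar>z\<bar>\<close> and \<open>\<bar>Z k\<bar>\<close> stay below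
    \<open>t\<close>, the move is at most \<open>\<theta> * (2 * t) = \<delta>\<close>. The factor
    \<open>4\<close> in the error counts two variables with two tails each.\<close>
  define t where "t = \<delta> / (2 * \<theta>)"
  have t: "0 \<le> t" unfolding t_def using \<theta> \<delta> by simp
  have gd1: "\<bar>g b - g c\<bar> \<le> 1" for b c
    using g01(1)[of b] g01(1)[of c] g01(2)[of b] g01(2)[of c] by linarith
  have gd: "\<bar>g a * \<bar>g b - g c\<bar>\<bar> \<le> 1" for a b c
    using gd1 g01 by (simp add: abs_mult mult_le_one)
  have gh: "\<bar>g a * h b\<bar> \<le> 1" for a b
    using g01 h01 by (simp add: abs_mult mult_le_one)
  let ?I = "\<lambda>z. indicator {z. t \<le> \<bar>z\<bar>} z :: real"
  have "(\<integral>w. g (Z k (fst w)) * \<bar>g (Z i (fst w)) - g (resampled k i w)\<bar> \<partial>(M \<Otimes>\<^sub>M N01)) \<le>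
      (\<integral>w. g (Z k (fst w)) * h (resampled k i w) + (?I (snd w) + ?I (Z k (fst w))) \<partial>(M \<Otimes>\<^sub>M N01))"
  proof (rule integral_mono)
    fix w
    show "g (Z k (fst w)) * \<bar>g (Z i (fst w)) - g (resampled k i w)\<bar> \<le>
      g (Z k (fst w)) * h (resampled k i w) + (?I (snd w) + ?I (Z k (fst w)))"
    proof (cases "t \<le> \<bar>snd w\<bar> \<or> t \<le> \<bar>Z k (fst w)\<bar>")
      case True
      have "0 \<le> g (Z k (fst w)) * h (resampled k i w)" using g01 h01 by simp
      moreover have "1 \<le> ?I (snd w) + ?I (Z k (fst w))" using True by (auto simp: indicator_def)
      ultimately show ?thesis
        using gd[of "Z k (fst w)" "Z i (fst w)" "resampled k i w"] by linarith
    next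
      case False
      have "\<bar>snd w - Z k (fst w)\<bar> \<le> 2 * t" using False by linarith
      then have "rho i k * \<bar>snd w - Z k (fst w)\<bar> \<le> \<theta> * (2 * t)"
        using r \<theta> t rho_nonneg by (intro mult_mono) auto
      moreover have "\<theta> * (2 * t) = \<delta>" unfolding t_def using \<theta> by simp
      ultimately have "\<bar>resampled k i w - Z i (fst w)\<bar> \<le> \<delta>"
        using rho_nonneg[of i k] by (simp add: resampled_def abs_mult)
      then have "g (resampled k i w - \<delta>) \<le> g (Z i (fst w))" "g (Z i (fst w)) \<le> g (resampled k i w + \<delta>)"
        "g (resampled k i w - \<delta>) \<le> g (resampled k i w)" "g (resampled k i w) \<le> g (resampled k i w + \<delta>)"
        using \<delta> by (auto intro!: monoD[OF mono])
      then have "\<bar>g (Z i (fst w)) - g (resampled k i w)\<bar> \<le> h (resampled k i w)"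
        unfolding h_def by linarith
      from mult_left_mono[OF this g01(1)] show ?thesis
        by (simp add: add_increasing2)
    qed
  qed (intro Bochner_Integration.integrable_add int gh gd; simp add: indicator_def)+
  also have "\<dots> = (\<integral>w. g (Z k (fst w)) * h (resampled k i w) \<partial>(M \<Otimes>\<^sub>M N01)) +
     ((\<integral>w. ?I (snd w) \<partial>(M \<Otimes>\<^sub>M N01)) + (\<integral>w. ?I (Z k (fst w)) \<partial>(M \<Otimes>\<^sub>M N01)))"
  proof -
    have "integrable (M \<Otimes>\<^sub>M N01) (\<lambda>w. g (Z k (fst w)) * h (resampled k i w))"
      "integrable (M \<Otimes>\<^sub>M N01) (\<lambda>w. ?I (snd w))" "integrable (M \<Otimes>\<^sub>M N01) (\<lambda>w. ?I (Z k (fst w)))"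
      by (intro int gh; simp add: indicator_def)+
    then show ?thesis by simp
  qed
  also have "(\<integral>w. g (Z k (fst w)) * h (resampled k i w) \<partial>(M \<Otimes>\<^sub>M N01)) = (\<integral>z. g z \<partial>N01) * (\<integral>z. h z \<partial>N01)"
    using resampled_independent[of "{i}" k g "\<lambda>_. h"] ik g01 h01 by (simp add: law_coordinate)
  also have "(\<integral>w. ?I (snd w) \<partial>(M \<Otimes>\<^sub>M N01)) = measure N01 {z. t \<le> \<bar>z\<bar>}"
    using integral_pair_eq_iterated[of "\<lambda>w. ?I (snd w)" 1] prob_space by simp
  also have "(\<integral>w. ?I (Z k (fst w)) \<partial>(M \<Otimes>\<^sub>M N01)) = measure N01 {z. t \<le> \<bar>z\<bar>}"
    using integral_pair_eq_iterated[of "\<lambda>w. ?I (Z k (fst w))" 1] N.prob_space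
      law_coordinate[of "indicator {z. t \<le> \<bar>z\<bar>}" k] by simp
  finally have "(\<integral>w. g (Z k (fst w)) * \<bar>g (Z i (fst w)) - g (resampled k i w)\<bar> \<partial>(M \<Otimes>\<^sub>M N01)) \<le>
    (\<integral>z. g z \<partial>N01) * (\<integral>z. h z \<partial>N01) + 4 * exp (- t\<^sup>2 / 2)"
    using std_normal_two_sided_tail_le[OF t] by simp
  also have "- t\<^sup>2 / 2 = - \<delta>\<^sup>2 / (8 * \<theta>\<^sup>2)"
    by (simp add: t_def power_divide power_mult_distrib)
  finally show ?thesis unfolding h_def .
qed

text \<open>The factor \<open>g (Z k)\<close> stays inside every summand because its expectation, of
  order \<open>1 / N\<close> in the application, is needed: about \<open>N\<^sup>2\<close> pairs are
  summed in the end, and the differences alone only supply \<open>o(1 / N)\<close>.\<close>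

lemma covariance_bound:
  fixes g :: "real \<Rightarrow> real"
  assumes S: "finite S" "k \<notin> S"
    and g[measurable]: "g \<in> borel_measurable borel" and g01: "\<And>x. 0 \<le> g x" "\<And>x. g x \<le> 1"
  shows "\<bar>(\<integral>\<omega>. g (Z k \<omega>) * (\<Prod>i\<in>S. 1 - g (Z i \<omega>)) \<partial>M) -
      (\<integral>z. g z \<partial>N01) * (\<integral>\<omega>. (\<Prod>i\<in>S. 1 - g (Z i \<omega>)) \<partial>M)\<bar>
    \<le> (\<Sum>i\<in>S. \<integral>w. g (Z k (fst w)) * \<bar>g (Z i (fst w)) - g (resampled k i w)\<bar> \<partial>(M \<Otimes>\<^sub>M N01))"
proof -
  have int: "integrable (M \<Otimes>\<^sub>M N01) h" if [measurable]: "h \<in> borel_measurable (M \<Otimes>\<^sub>M N01)" and "\<And>w. \<bar>h w\<bar> \<le> 1" for h :: "_ \<Rightarrow> real"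
    by (rule P.integrable_const_bound[where B=1]) (use that in auto)
  have gd1: "\<bar>g b - g c\<bar> \<le> 1" for b c
    using g01(1)[of b] g01(1)[of c] g01(2)[of b] g01(2)[of c] by linarith
  have gd: "\<bar>g a * \<bar>g b - g c\<bar>\<bar> \<le> 1" for a b c
    using gd1 g01 by (simp add: abs_mult mult_le_one)
  have gp: "\<bar>g a * (\<Prod>i\<in>S. 1 - g (V i))\<bar> \<le> 1" for a V
    using g01 by (auto simp: abs_mult abs_prod intro!: mult_le_one prod_nonneg prod_le_1)
  let ?A = "\<lambda>w. g (Z k (fst w)) * (\<Prod>i\<in>S. 1 - g (Z i (fst w)))"
  let ?B = "\<lambda>w. g (Z k (fst w)) * (\<Prod>i\<in>S. 1 - g (resampled k i w))"
  have iA: "integrable (M \<Otimes>\<^sub>M N01) ?A" and iB: "integrable (M \<Otimes>\<^sub>M N01) ?B"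
    by (intro int gp; measurable)+
  have A: "(\<integral>w. ?A w \<partial>(M \<Otimes>\<^sub>M N01)) = (\<integral>\<omega>. g (Z k \<omega>) * (\<Prod>i\<in>S. 1 - g (Z i \<omega>)) \<partial>M)"
    by (subst integral_pair_eq_iterated[where C=1]) (use gp N.prob_space in auto)
  have B: "(\<integral>w. ?B w \<partial>(M \<Otimes>\<^sub>M N01)) = (\<integral>z. g z \<partial>N01) * (\<integral>\<omega>. (\<Prod>i\<in>S. 1 - g (Z i \<omega>)) \<partial>M)"
    using resampled_independent[of S k g "\<lambda>_ z. 1 - g z"] S g01 by simp
  have "\<bar>(\<integral>w. ?A w \<partial>(M \<Otimes>\<^sub>M N01)) - (\<integral>w. ?B w \<partial>(M \<Otimes>\<^sub>M N01))\<bar> = \<bar>\<integral>w. ?A w - ?B w \<partial>(M \<Otimes>\<^sub>M N01)\<bar>"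
    using iA iB by simp
  also have "\<dots> \<le> (\<integral>w. \<bar>?A w - ?B w\<bar> \<partial>(M \<Otimes>\<^sub>M N01))"
    by (rule integral_abs_bound)
  also have "\<dots> \<le> (\<integral>w. (\<Sum>i\<in>S. g (Z k (fst w)) * \<bar>g (Z i (fst w)) - g (resampled k i w)\<bar>) \<partial>(M \<Otimes>\<^sub>M N01))"
  proof (rule integral_mono)
    show "integrable (M \<Otimes>\<^sub>M N01) (\<lambda>w. \<bar>?A w - ?B w\<bar>)" using iA iB by simp
    show "integrable (M \<Otimes>\<^sub>M N01) (\<lambda>w. \<Sum>i\<in>S. g (Z k (fst w)) * \<bar>g (Z i (fst w)) - g (resampled k i w)\<bar>)"
      by (intro Bochner_Integration.integrable_sum int gd) measurable
    fix w
    have "norm ((\<Prod>i\<in>S. 1 - g (Z i (fst w))) - (\<Prod>i\<in>S. 1 - g (resampled k i w))) \<le>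
        (\<Sum>i\<in>S. norm ((1 - g (Z i (fst w))) - (1 - g (resampled k i w))))"
      using g01 by (intro norm_prod_diff) auto
    also have "\<dots> = (\<Sum>i\<in>S. \<bar>g (Z i (fst w)) - g (resampled k i w)\<bar>)"
      by (intro sum.cong) auto
    finally have "g (Z k (fst w)) * \<bar>(\<Prod>i\<in>S. 1 - g (Z i (fst w))) - (\<Prod>i\<in>S. 1 - g (resampled k i w))\<bar> \<le>
       g (Z k (fst w)) * (\<Sum>i\<in>S. \<bar>g (Z i (fst w)) - g (resampled k i w)\<bar>)"
      using g01 by (intro mult_left_mono) auto
    then show "\<bar>?A w - ?B w\<bar> \<le> (\<Sum>i\<in>S. g (Z k (fst w)) * \<bar>g (Z i (fst w)) - g (resampled k i w)\<bar>)"
      using g01 by (simp add: right_diff_distrib[symmetric] abs_mult sum_distrib_left)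
  qed
  also have "\<dots> = (\<Sum>i\<in>S. \<integral>w. g (Z k (fst w)) * \<bar>g (Z i (fst w)) - g (resampled k i w)\<bar> \<partial>(M \<Otimes>\<^sub>M N01))"
    by (intro Bochner_Integration.integral_sum int gd) measurable
  finally show ?thesis unfolding A B .
qed

text \<open>Splitting off \<open>k\<close> multiplies the expectation by \<open>1 - p\<close> up to
  \<open>\<epsilon>\<close>, where \<open>p\<close> is the mean of \<open>g\<close>. Earlier errors
  are not amplified since \<open>0 \<le> 1 - p \<le> 1\<close>, so they add up to
  \<open>card S * \<epsilon>\<close>.\<close>

lemma prod_integral_telescope:
  fixes g :: "real \<Rightarrow> real"
  assumes S: "finite S"
    and g[measurable]: "g \<in> borel_measurable borel" and g01: "\<And>x. 0 \<le> g x" "\<And>x. g x \<le> 1"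
    and \<epsilon>: "\<And>k T. k \<in> S \<Longrightarrow> T \<subseteq> S - {k} \<Longrightarrow>
      (\<Sum>i\<in>T. \<integral>w. g (Z k (fst w)) * \<bar>g (Z i (fst w)) - g (resampled k i w)\<bar> \<partial>(M \<Otimes>\<^sub>M N01)) \<le> \<epsilon>"
  shows "\<bar>(\<integral>\<omega>. (\<Prod>i\<in>S. 1 - g (Z i \<omega>)) \<partial>M) - (1 - (\<integral>z. g z \<partial>N01)) ^ card S\<bar> \<le> real (card S) * \<epsilon>"
proof -
  let ?p = "\<integral>z. g z \<partial>N01"
  have p0: "0 \<le> ?p" using g01 by simp
  have "?p \<le> (\<integral>z. 1 \<partial>N01)"
    by (rule integral_mono) (auto intro!: N.integrable_const_bound[where B=1] simp: g01)
  then have p1: "?p \<le> 1" using N.prob_space by simp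
  have "\<bar>(\<integral>\<omega>. (\<Prod>i\<in>T. 1 - g (Z i \<omega>)) \<partial>M) - (1 - ?p) ^ card T\<bar> \<le> real (card T) * \<epsilon>"
    if "finite T" "T \<subseteq> S" for T
    using that
  proof (induction T rule: finite_induct)
    case empty
    then show ?case using prob_space by simp
  next
    case (insert k T)
    let ?E = "\<integral>\<omega>. (\<Prod>i\<in>T. 1 - g (Z i \<omega>)) \<partial>M"
    let ?C = "\<integral>\<omega>. g (Z k \<omega>) * (\<Prod>i\<in>T. 1 - g (Z i \<omega>)) \<partial>M"
    have i1: "integrable M (\<lambda>\<omega>. \<Prod>i\<in>T. 1 - g (Z i \<omega>))"
      by (rule integrable_const_bound[where B=1])
        (use g01 in \<open>auto simp: abs_prod intro!: prod_le_1\<close>)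
    have i2: "integrable M (\<lambda>\<omega>. g (Z k \<omega>) * (\<Prod>i\<in>T. 1 - g (Z i \<omega>)))"
      by (rule integrable_const_bound[where B=1])
        (use g01 in \<open>auto simp: abs_mult abs_prod intro!: mult_le_one prod_le_1 prod_nonneg\<close>)
    have "\<bar>?C - ?p * ?E\<bar> \<le> \<epsilon>"
      using covariance_bound[of T k g] insert \<epsilon>[of k T] g01 by force
    moreover have "\<bar>?E - (1 - ?p) ^ card T\<bar> \<le> real (card T) * \<epsilon>"
      using insert by simp
    moreover have "(\<integral>\<omega>. (\<Prod>i\<in>insert k T. 1 - g (Z i \<omega>)) \<partial>M) = ?E - ?C"
      using insert i1 i2 by (simp add: left_diff_distrib)
    moreover have "\<bar>(1 - ?p) * (?E - (1 - ?p) ^ card T)\<bar> \<le> 1 * \<bar>?E - (1 - ?p) ^ card T\<bar>"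
      unfolding abs_mult using p0 p1 by (intro mult_right_mono) auto
    ultimately have "\<bar>(\<integral>\<omega>. (\<Prod>i\<in>insert k T. 1 - g (Z i \<omega>)) \<partial>M) - (1 - ?p) * (1 - ?p) ^ card T\<bar>
        \<le> real (card T) * \<epsilon> + \<epsilon>"
      by (simp add: algebra_simps)
    then show ?case using insert by (simp add: algebra_simps)
  qed
  then show ?thesis using S by simp
qed

text \<open>For each \<open>k\<close>, at most \<open>m\<close> partners fall under the near bound
  and at most \<open>n\<close> under the far bound. Both bounds are nonnegative, which allows the
  counts to be replaced by these upper estimates.\<close>

theorem prod_integral_bound:
  fixes g :: "real \<Rightarrow> real"
  assumes S: "finite S" and n: "card S = n"
    and mono: "mono g" and g01: "\<And>x. 0 \<le> g x" "\<And>x. g x \<le> 1"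
    and u: "0 \<le> u" "\<And>z. z < u \<Longrightarrow> g z = 0"
    and \<theta>: "0 < \<theta>" and \<delta>: "0 < \<delta>"
    and half: "\<And>x y. x \<noteq> y \<Longrightarrow> rho x y \<le> 1 / 2"
    and near: "\<And>k. finite {i. \<theta> \<le> rho i k}" "\<And>k. real (card {i. \<theta> \<le> rho i k}) \<le> m"
  shows "\<bar>(\<integral>\<omega>. (\<Prod>i\<in>S. 1 - g (Z i \<omega>)) \<partial>M) - (1 - (\<integral>z. g z \<partial>N01)) ^ n\<bar> \<le>
    real n * (m * (exp (- 2 * u\<^sup>2 / 3) + (\<integral>z. g z \<partial>N01)\<^sup>2) +
      real n * ((\<integral>z. g z \<partial>N01) * (\<integral>z. g (z + \<delta>) - g (z - \<delta>) \<partial>N01) + 4 * exp (- \<delta>\<^sup>2 / (8 * \<theta>\<^sup>2))))"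
  (is "_ \<le> real n * (m * ?A + real n * ?B)")
proof -
  have g[measurable]: "g \<in> borel_measurable borel" using mono by (rule borel_measurable_mono)
  have A: "0 \<le> ?A" by simp
  have "0 \<le> (\<integral>z. g (z + \<delta>) - g (z - \<delta>) \<partial>N01)"
    using \<delta> by (intro Bochner_Integration.integral_nonneg) (auto intro!: monoD[OF mono])
  then have B: "0 \<le> ?B" using g01 by simp
  show ?thesis
    unfolding n[symmetric]
  proof (rule prod_integral_telescope[OF S g g01])
    fix k T assume k: "k \<in> S" and T: "T \<subseteq> S - {k}"
    have fin: "finite T" using T S by (meson finite_Diff finite_subset)
    let ?e = "\<lambda>i. \<integral>w. g (Z k (fst w)) * \<bar>g (Z i (fst w)) - g (resampled k i w)\<bar> \<partial>(M \<Otimes>\<^sub>M N01)"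
    let ?N = "{i. \<theta> \<le> rho i k}"
    have "sum ?e T = sum ?e (T \<inter> ?N) + sum ?e (T - ?N)"
      using fin by (rule sum.Int_Diff)
    also have "sum ?e (T \<inter> ?N) \<le> real (card (T \<inter> ?N)) * ?A"
    proof (rule sum_bounded_above)
      fix i assume "i \<in> T \<inter> ?N"
      then have "i \<noteq> k" using T by auto
      then show "?e i \<le> ?A" by (intro near_pair_bound half g g01 u)
    qed
    also have "\<dots> \<le> m * ?A"
    proof (rule mult_right_mono[OF _ A])
      have "card (T \<inter> ?N) \<le> card ?N" by (intro card_mono near) auto
      then show "real (card (T \<inter> ?N)) \<le> m" using near(2)[of k] by linarith
    qed
    also have "sum ?e (T - ?N) \<le> real (card (T - ?N)) * ?B"
    proof (rule sum_bounded_above)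
      fix i assume "i \<in> T - ?N"
      then have "i \<noteq> k" "rho i k \<le> \<theta>" using T by auto
      then show "?e i \<le> ?B" by (intro far_pair_bound \<theta> \<delta> mono g01)
    qed
    also have "\<dots> \<le> real (card S) * ?B"
    proof (rule mult_right_mono[OF _ B])
      have "card (T - ?N) \<le> card S" using T S by (intro card_mono) auto
      then show "real (card (T - ?N)) \<le> real (card S)" by simp
    qed
    finally show "sum ?e T \<le> m * ?A + real (card S) * ?B" by simp
  qed
qed

end

section \<open>Asymptotics at the scale of the maximum\<close>

lemma aN_at_top: "filterlim aN at_top at_top"
  unfolding aN_def by real_asymp

lemma aN_square:
  assumes "N \<ge> 2"
  shows "(aN N)\<^sup>2 = 2 * ln (real N) - (ln (ln (real N)) + ln (4 * pi))
    + (ln (ln (real N)) + ln (4 * pi))\<^sup>2 / (8 * ln (real N))"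
proof -
  have L: "0 < ln (real N)" using assms by simp
  have "(x - y / (2 * x))\<^sup>2 = x\<^sup>2 - y + y\<^sup>2 / (4 * x\<^sup>2)" if "x > 0" for x y :: real
    using that by (simp add: power2_eq_square field_simps)
  from this[of "sqrt (2 * ln (real N))"] L show ?thesis
    unfolding aN_def by simp
qed

text \<open>By the Mills ratio the left-hand side is asymptotically the expected number of values
  above \<open>aN N\<close>. The logarithmic correction in \<open>aN\<close> contributes the factor
  \<open>sqrt (4 * pi * ln N)\<close> to the exponential, which cancels
  \<open>aN N * sqrt (2 * pi)\<close> asymptotically.\<close>

lemma aN_calibration:
  "(\<lambda>N. real N / (aN N * sqrt (2 * pi)) * exp (- (aN N)\<^sup>2 / 2)) \<longlonglongrightarrow> 1"
proof -
  have "(\<lambda>N. sqrt (2 * ln (real N)) / aN N *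
      exp (- (ln (ln (real N)) + ln (4 * pi))\<^sup>2 / (16 * ln (real N)))) \<longlonglongrightarrow> 1 * 1"
  proof (rule tendsto_mult)
    show "(\<lambda>N. sqrt (2 * ln (real N)) / aN N) \<longlonglongrightarrow> 1"
      unfolding aN_def by real_asymp
    show "(\<lambda>N. exp (- (ln (ln (real N)) + ln (4 * pi))\<^sup>2 / (16 * ln (real N)))) \<longlonglongrightarrow> 1"
      by real_asymp
  qed
  moreover have "sqrt (2 * ln (real N)) / aN N *
      exp (- (ln (ln (real N)) + ln (4 * pi))\<^sup>2 / (16 * ln (real N))) =
      real N / (aN N * sqrt (2 * pi)) * exp (- (aN N)\<^sup>2 / 2)" if N: "N \<ge> 2" for N
  proof -
    have L: "0 < ln (real N)" using N by simp
    let ?y = "ln (ln (real N)) + ln (4 * pi)"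
    have "exp (- (aN N)\<^sup>2 / 2) = exp (- ln (real N)) * exp (?y / 2) * exp (- ?y\<^sup>2 / (16 * ln (real N)))"
      unfolding exp_add[symmetric] aN_square[OF N] by (simp add: field_simps)
    moreover have "exp (- ln (real N)) = 1 / real N"
      using N by (simp add: exp_minus inverse_eq_divide)
    moreover have "exp (?y / 2) = sqrt (2 * ln (real N)) * sqrt (2 * pi)"
    proof -
      have "?y = ln (4 * pi * ln (real N))" using L by (simp add: ln_mult_pos)
      then have "exp ?y = 4 * pi * ln (real N)" using L by (simp add: exp_ln)
      moreover have "(exp (?y / 2))\<^sup>2 = exp ?y" by (simp add: power2_eq_square exp_add[symmetric])
      ultimately have "(exp (?y / 2))\<^sup>2 = (sqrt (2 * ln (real N)) * sqrt (2 * pi))\<^sup>2"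
        using L by (simp add: power_mult_distrib)
      then show ?thesis by (rule power2_eq_imp_eq) (use L in auto)
    qed
    ultimately show ?thesis using N by simp
  qed
  ultimately show ?thesis
    by (auto elim!: Lim_transform_eventually intro!: eventually_sequentiallyI[of 2])
qed

text \<open>Here \<open>7 / 6 - 4 / 3 = - 1 / 6\<close> beats the power of the logarithm that comes
  from the correction in \<open>aN\<close>. The squares dropped in the two estimates of the exponent
  have the favourable sign.\<close>

lemma near_pairs_negligible:
  "(\<lambda>N. real N powr (7 / 6) * exp (- 2 * (aN N - K / aN N)\<^sup>2 / 3)) \<longlonglongrightarrow> 0"
proof (rule tendsto_sandwich)
  show "(\<lambda>_. 0) \<longlonglongrightarrow> (0::real)" by simp
  have "(\<lambda>N. exp (- ln (real N) / 6 + 2 / 3 * (ln (ln (real N)) + ln (4 * pi)))) \<longlonglongrightarrow> 0"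
    by real_asymp
  from tendsto_mult_left[OF this, of "exp (4 * K / 3)"]
  show "(\<lambda>N. exp (4 * K / 3) * exp (- ln (real N) / 6 + 2 / 3 * (ln (ln (real N)) + ln (4 * pi)))) \<longlonglongrightarrow> 0"
    by simp
  show "\<forall>\<^sub>F N in sequentially. 0 \<le> real N powr (7 / 6) * exp (- 2 * (aN N - K / aN N)\<^sup>2 / 3)"
    by simp
  have "\<forall>\<^sub>F N in sequentially. 0 < aN N"
    using aN_at_top by (simp add: filterlim_at_top_dense)
  then show "\<forall>\<^sub>F N in sequentially. real N powr (7 / 6) * exp (- 2 * (aN N - K / aN N)\<^sup>2 / 3) \<le>
      exp (4 * K / 3) * exp (- ln (real N) / 6 + 2 / 3 * (ln (ln (real N)) + ln (4 * pi)))"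
    using eventually_ge_at_top[of 2]
  proof eventually_elim
    case (elim N)
    have L: "0 < ln (real N)" using elim by simp
    have "(aN N - K / aN N)\<^sup>2 = (aN N)\<^sup>2 - 2 * K + (K / aN N)\<^sup>2"
      using elim by (simp add: power2_diff)
    then have "(aN N - K / aN N)\<^sup>2 \<ge> (aN N)\<^sup>2 - 2 * K" by simp
    moreover have "(aN N)\<^sup>2 \<ge> 2 * ln (real N) - (ln (ln (real N)) + ln (4 * pi))"
      using L unfolding aN_square[OF elim(2)] by simp
    ultimately have "7 / 6 * ln (real N) + - 2 * (aN N - K / aN N)\<^sup>2 / 3 \<le>
       4 * K / 3 + (- ln (real N) / 6 + 2 / 3 * (ln (ln (real N)) + ln (4 * pi)))"
      by argo
    then show ?case
      using elim by (simp add: powr_def exp_add[symmetric])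
  qed
qed

lemma has_bochner_integral_exp_atLeast:
  fixes a :: real
  shows "has_bochner_integral lborel (\<lambda>s. indicator {a..} s * exp (- s)) (exp (- a))"
proof (rule has_bochner_integral_nn_integral)
  have "(\<integral>\<^sup>+s. ennreal (exp (- s)) * indicator {a..} s \<partial>lborel) = ennreal (0 - (- exp (- a)))"
  proof (rule nn_integral_FTC_atLeast)
    show "((\<lambda>s::real. - exp (- s)) \<longlongrightarrow> 0) at_top" by real_asymp
  qed (auto intro!: derivative_eq_intros)
  then show "(\<integral>\<^sup>+s. ennreal (indicator {a..} s * exp (- s)) \<partial>lborel) = ennreal (exp (- a))"
    by (simp add: ennreal_mult ennreal_indicator mult.commute)
qed auto

lemma integrable_exp_bounded:
  fixes h :: "real \<Rightarrow> real"
  assumes [measurable]: "h \<in> borel_measurable borel" and b: "\<And>s. \<bar>h s\<bar> \<le> C" and z: "\<And>s. s < a \<Longrightarrow> h s = 0"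
  shows "integrable lborel (\<lambda>s. h s * exp (- s))"
proof (rule Bochner_Integration.integrable_bound)
  show "integrable lborel (\<lambda>s. C * (indicator {a..} s * exp (- s)))"
    using has_bochner_integral_exp_atLeast[of a]
    by (intro integrable_mult_right) (auto simp: has_bochner_integral_iff)
  show "AE s in lborel. norm (h s * exp (- s)) \<le> norm (C * (indicator {a..} s * exp (- s)))"
  proof (rule AE_I2)
    fix s
    have "0 \<le> C" using b[of s] by linarith
    then show "norm (h s * exp (- s)) \<le> norm (C * (indicator {a..} s * exp (- s)))"
      using b[of s] z[of s] by (auto simp: abs_mult indicator_def)
  qed
qed simp

text \<open>With \<open>z = a + s / a\<close> the exponent \<open>z\<^sup>2 / 2\<close> becomes
  \<open>a\<^sup>2 / 2 + s + (s / a)\<^sup>2 / 2\<close>: the first term goes into the calibrated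
  constant, the second is the intensity, the third vanishes in the limit. The integrand may depend
  on \<open>N\<close>, since the lemma also serves differences over shrinking windows, whose support
  is controlled only from some \<open>m\<close> on.\<close>

lemma rescaled_integral_tendsto:
  fixes h :: "nat \<Rightarrow> real \<Rightarrow> real" and h' :: "real \<Rightarrow> real"
  assumes [measurable]: "\<And>N. h N \<in> borel_measurable borel" "h' \<in> borel_measurable borel"
    and b: "\<And>N s. \<bar>h N s\<bar> \<le> 1"
    and z: "\<And>N s. N \<ge> m \<Longrightarrow> s < - K \<Longrightarrow> h N s = 0"
    and lim: "AE s in lborel. (\<lambda>N. h N s) \<longlonglongrightarrow> h' s"
  shows "(\<lambda>N. real N * (\<integral>z. h N ((z - aN N) * aN N) \<partial>std_normal_distribution))
    \<longlonglongrightarrow> (\<integral>s. h' s * exp (- s) \<partial>lborel)"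
proof -
  define \<kappa> where "\<kappa> N = real N / (aN N * sqrt (2 * pi)) * exp (- (aN N)\<^sup>2 / 2)" for N
  have \<kappa>: "\<kappa> \<longlonglongrightarrow> 1" unfolding \<kappa>_def by (rule aN_calibration)
  define F where "F N s = \<kappa> N * (h N s * exp (- s - (s / aN N)\<^sup>2 / 2))" for N s
  have eq: "real N * (\<integral>z. h N ((z - aN N) * aN N) \<partial>std_normal_distribution) = (\<integral>s. F N s \<partial>lborel)"
    if a: "0 < aN N" for N
  proof -
    have "(\<integral>z. h N ((z - aN N) * aN N) \<partial>std_normal_distribution) =
      (\<integral>z. std_normal_density z * h N ((z - aN N) * aN N) \<partial>lborel)"
      by (rule std_normal_integral_density) simp
    also have "\<dots> = \<bar>1 / aN N\<bar> *\<^sub>R (\<integral>s. std_normal_density (aN N + 1 / aN N * s) * h N (((aN N + 1 / aN N * s) - aN N) * aN N) \<partial>lborel)"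
      using a by (intro lborel_integral_real_affine) simp
    finally have "real N * (\<integral>z. h N ((z - aN N) * aN N) \<partial>std_normal_distribution) =
      (\<integral>s. real N / aN N * (std_normal_density (aN N + s / aN N) * h N s) \<partial>lborel)"
      using a by simp
    also have "(\<lambda>s. real N / aN N * (std_normal_density (aN N + s / aN N) * h N s)) = F N"
    proof
      fix s
      have "- (aN N + s / aN N)\<^sup>2 / 2 = - (aN N)\<^sup>2 / 2 + (- s - (s / aN N)\<^sup>2 / 2)"
        using a by (simp add: power2_eq_square field_simps)
      then have "exp (- (aN N + s / aN N)\<^sup>2 / 2) = exp (- (aN N)\<^sup>2 / 2) * exp (- s - (s / aN N)\<^sup>2 / 2)"
        by (simp only: exp_add)
      then show "real N / aN N * (std_normal_density (aN N + s / aN N) * h N s) = F N s"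
        unfolding F_def \<kappa>_def std_normal_density_def by simp
    qed
    finally show ?thesis .
  qed
  have "\<forall>\<^sub>F N in sequentially. 0 < aN N"
    using aN_at_top by (simp add: filterlim_at_top_dense)
  moreover have "\<forall>\<^sub>F N in sequentially. \<bar>\<kappa> N\<bar> < 2"
    using order_tendstoD(2)[OF tendsto_rabs[OF \<kappa>], of 2] by simp
  ultimately have "\<forall>\<^sub>F N in sequentially. N \<ge> m \<and> 0 < aN N \<and> \<bar>\<kappa> N\<bar> < 2"
    using eventually_ge_at_top[of m] by eventually_elim simp
  \<comment> \<open>The index is shifted by \<open>n1\<close> so that the substitution and the
    dominating function \<open>2 * exp (- s)\<close> are available for every member of the
    sequence.\<close>
  then obtain n1 where n1: "\<And>N. N \<ge> n1 \<Longrightarrow> N \<ge> m \<and> 0 < aN N \<and> \<bar>\<kappa> N\<bar> < 2"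
    unfolding eventually_sequentially by blast
  have "(\<lambda>N. \<integral>s. F (N + n1) s \<partial>lborel) \<longlonglongrightarrow> (\<integral>s. h' s * exp (- s) \<partial>lborel)"
  proof (rule integral_dominated_convergence)
    show "integrable lborel (\<lambda>s. 2 * (indicator {- K..} s * exp (- s)))"
      using has_bochner_integral_exp_atLeast[of "- K"]
      by (intro integrable_mult_right) (auto simp: has_bochner_integral_iff)
    show "AE s in lborel. (\<lambda>N. F (N + n1) s) \<longlonglongrightarrow> h' s * exp (- s)"
      using lim
    proof eventually_elim
      case (elim s)
      have "(\<lambda>N. s / aN N) \<longlonglongrightarrow> 0"
        using aN_at_top by (intro tendsto_divide_0[OF tendsto_const] filterlim_at_top_imp_at_infinity)
      then have "(\<lambda>N. F N s) \<longlonglongrightarrow> 1 * (h' s * exp (- s - 0\<^sup>2 / 2))"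
        unfolding F_def by (intro tendsto_intros \<kappa> elim) auto
      then have "(\<lambda>N. F N s) \<longlonglongrightarrow> h' s * exp (- s)" by simp
      then show ?case by (rule LIMSEQ_ignore_initial_segment)
    qed
    show "AE s in lborel. norm (F (N + n1) s) \<le> 2 * (indicator {- K..} s * exp (- s))" for N
    proof (rule AE_I2)
      fix s
      have n: "N + n1 \<ge> m" "\<bar>\<kappa> (N + n1)\<bar> < 2" using n1[of "N + n1"] by auto
      show "norm (F (N + n1) s) \<le> 2 * (indicator {- K..} s * exp (- s))"
      proof (cases "s < - K")
        case True
        then show ?thesis using z[OF n(1) True] by (simp add: F_def)
      next
        case False
        have "\<bar>\<kappa> (N + n1)\<bar> * (\<bar>h (N + n1) s\<bar> * exp (- s - (s / aN (N + n1))\<^sup>2 / 2)) \<le> 2 * (1 * exp (- s))"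
          using n b by (intro mult_mono) auto
        then show ?thesis using False by (simp add: F_def abs_mult)
      qed
    qed
  qed (simp_all add: F_def)
  then have "(\<lambda>N. \<integral>s. F N s \<partial>lborel) \<longlonglongrightarrow> (\<integral>s. h' s * exp (- s) \<partial>lborel)"
    by (rule LIMSEQ_offset)
  then show ?thesis
    by (rule Lim_transform_eventually) (use n1 eq in \<open>auto intro!: eventually_sequentiallyI[of n1]\<close>)
qed

lemma AE_isCont_of_mono:
  fixes g :: "real \<Rightarrow> real"
  assumes "mono g"
  shows "AE s in lborel. isCont g s"
proof -
  have "countable {s. \<not> isCont g s}"
    using mono_ctble_discont[OF assms] .
  then have "{s. \<not> isCont g s} \<in> null_sets lborel"
    by (rule countable_imp_null_set_lborel)
  then show ?thesis by (rule AE_I') auto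
qed

text \<open>Both bases lie in \<open>[0, 1]\<close>, so the powers differ by at most
  \<open>N\<close> times the difference of the bases, that is by at most
  \<open>N * p\<^sup>2 = (N * p)\<^sup>2 / N\<close>.\<close>

lemma power_one_minus_tendsto_exp:
  fixes p :: "nat \<Rightarrow> real"
  assumes p: "\<And>N. 0 \<le> p N" "\<And>N. p N \<le> 1" and lim: "(\<lambda>N. real N * p N) \<longlonglongrightarrow> l"
  shows "(\<lambda>N. (1 - p N) ^ N) \<longlonglongrightarrow> exp (- l)"
proof -
  have "(\<lambda>N. (real N * p N) * ((real N * p N) * (1 / real N))) \<longlonglongrightarrow> l * (l * 0)"
    by (intro tendsto_mult lim lim_1_over_n)
  then have 1: "(\<lambda>N. (real N * p N) * ((real N * p N) * (1 / real N))) \<longlonglongrightarrow> 0" by simp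
  have "(\<lambda>N. (1 - p N) ^ N - exp (- p N) ^ N) \<longlonglongrightarrow> 0"
  proof (rule Lim_null_comparison[OF _ 1], rule eventually_sequentiallyI[of 1])
    fix N :: nat assume N: "1 \<le> N"
    have "norm ((1 - p N) ^ N - exp (- p N) ^ N) \<le> real N * norm ((1 - p N) - exp (- p N))"
      using p by (intro norm_power_diff) auto
    also have "norm ((1 - p N) - exp (- p N)) \<le> (p N)\<^sup>2"
    proof -
      have "1 - p N \<le> exp (- p N)" using exp_ge_add_one_self[of "- p N"] by simp
      moreover have "exp (- p N) \<le> 1 - p N + (p N)\<^sup>2"
      proof -
        \<comment> \<open>This is
          \<open>exp (- p) \<le> 1 / (1 + p) \<le> 1 - p + p\<^sup>2\<close>, the last step by
          \<open>(1 - p + p\<^sup>2) * (1 + p) = 1 + p ^ 3\<close>.\<close>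
        have "exp (- p N) * (1 + p N) \<le> exp (- p N) * exp (p N)"
          by (intro mult_left_mono exp_ge_add_one_self) auto
        also have "\<dots> = 1" by (simp add: exp_add[symmetric])
        also have "1 \<le> 1 + p N ^ 3" using p by simp
        also have "\<dots> = (1 - p N + (p N)\<^sup>2) * (1 + p N)"
          by (simp add: power2_eq_square power3_eq_cube algebra_simps)
        finally show ?thesis using p(1)[of N] by simp
      qed
      ultimately show ?thesis by simp
    qed
    finally show "norm ((1 - p N) ^ N - exp (- p N) ^ N) \<le> (real N * p N) * ((real N * p N) * (1 / real N))"
      using N by (simp add: power2_eq_square mult_left_mono)
  qed
  moreover have "(\<lambda>N. exp (- p N) ^ N) \<longlonglongrightarrow> exp (- l)"
  proof -
    have "(\<lambda>N. exp (- (real N * p N))) \<longlonglongrightarrow> exp (- l)" by (intro tendsto_intros lim)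
    then show ?thesis by (simp add: exp_of_nat_mult[symmetric])
  qed
  ultimately have "(\<lambda>N. ((1 - p N) ^ N - exp (- p N) ^ N) + exp (- p N) ^ N) \<longlonglongrightarrow> 0 + exp (- l)"
    by (rule tendsto_add)
  then show ?thesis by simp
qed

theorem (in gaussian_field) prod_integral_tendsto:
  fixes g :: "real \<Rightarrow> real" and S :: "nat \<Rightarrow> 'v set"
  assumes S: "\<And>N. finite (S N)" "\<And>N. card (S N) = N"
    and mono: "mono g" and g01: "\<And>x. 0 \<le> g x" "\<And>x. g x \<le> 1"
    and K: "\<And>z. z < - K \<Longrightarrow> g z = 0"
    and half: "\<And>x y. x \<noteq> y \<Longrightarrow> rho x y \<le> 1 / 2"
    and near: "\<And>k \<theta>. 0 < \<theta> \<Longrightarrow> \<theta> \<le> 1 \<Longrightarrow> finite {i. \<theta> \<le> rho i k}"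
      "\<And>k \<theta>. 0 < \<theta> \<Longrightarrow> \<theta> \<le> 1 \<Longrightarrow> real (card {i. \<theta> \<le> rho i k}) \<le> 1 / \<theta>\<^sup>2"
  shows "(\<lambda>N. \<integral>\<omega>. (\<Prod>i\<in>S N. 1 - g ((Z i \<omega> - aN N) * aN N)) \<partial>M)
    \<longlonglongrightarrow> exp (- (\<integral>s. g s * exp (- s) \<partial>lborel))"
proof -
  have [measurable]: "g \<in> borel_measurable borel" using mono by (rule borel_measurable_mono)
  define G where "G N z = g ((z - aN N) * aN N)" for N z
  have [measurable]: "G N \<in> borel_measurable borel" for N unfolding G_def by measurable
  have G01: "0 \<le> G N z" "G N z \<le> 1" for N z unfolding G_def by (auto simp: g01)
  define p where "p N = (\<integral>z. G N z \<partial>N01)" for N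
  define \<theta> :: "nat \<Rightarrow> real" where "\<theta> N = real N powr (- 1 / 12)" for N
  define \<delta> :: "nat \<Rightarrow> real" where "\<delta> N = real N powr (- 1 / 24)" for N
  define q where "q N = (\<integral>z. G N (z + \<delta> N) - G N (z - \<delta> N) \<partial>N01)" for N
  define l where "l = (\<integral>s. g s * exp (- s) \<partial>lborel)"
  have p0: "0 \<le> p N" for N unfolding p_def using G01 by simp
  have "p N \<le> (\<integral>z. 1 \<partial>N01)" for N
    unfolding p_def by (rule integral_mono) (auto intro!: N.integrable_const_bound[where B=1] simp: G01)
  then have p1: "p N \<le> 1" for N using N.prob_space by simp
  have Np: "(\<lambda>N. real N * p N) \<longlonglongrightarrow> l"
    unfolding p_def G_def l_def
    by (rule rescaled_integral_tendsto[where m=0 and K=K]) (use K g01 in auto)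
  have \<delta>a: "(\<lambda>N. \<delta> N * aN N) \<longlonglongrightarrow> 0"
    unfolding \<delta>_def aN_def by real_asymp
  have "\<forall>\<^sub>F N in sequentially. \<bar>\<delta> N * aN N\<bar> < 1"
    using order_tendstoD(2)[OF tendsto_rabs[OF \<delta>a], of 1] by simp
  then obtain n0 where n0: "\<And>N. N \<ge> n0 \<Longrightarrow> \<bar>\<delta> N * aN N\<bar> < 1"
    unfolding eventually_sequentially by blast
  have Nq: "(\<lambda>N. real N * q N) \<longlonglongrightarrow> 0"
  proof -
    have "(\<lambda>N. real N * (\<integral>z. (\<lambda>s. g (s + \<delta> N * aN N) - g (s - \<delta> N * aN N)) ((z - aN N) * aN N) \<partial>N01))
      \<longlonglongrightarrow> (\<integral>s. 0 * exp (- s) \<partial>lborel)"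
    \<comment> \<open>From \<open>n0\<close> on the rescaled half-width is below 1, so the support
      reaches at most one unit further left than that of \<open>g\<close>.\<close>
    proof (rule rescaled_integral_tendsto[where m=n0 and K="K + 1"])
      show "\<bar>g (s + \<delta> N * aN N) - g (s - \<delta> N * aN N)\<bar> \<le> 1" for N s
        using g01(1)[of "s + \<delta> N * aN N"] g01(1)[of "s - \<delta> N * aN N"]
          g01(2)[of "s + \<delta> N * aN N"] g01(2)[of "s - \<delta> N * aN N"] by linarith
      show "g (s + \<delta> N * aN N) - g (s - \<delta> N * aN N) = 0" if "n0 \<le> N" "s < - (K + 1)" for N s
        using n0[OF that(1)] that(2) K[of "s + \<delta> N * aN N"] K[of "s - \<delta> N * aN N"] by simp
      show "AE s in lborel. (\<lambda>N. g (s + \<delta> N * aN N) - g (s - \<delta> N * aN N)) \<longlonglongrightarrow> 0"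
        using AE_isCont_of_mono[OF mono]
      proof eventually_elim
        case (elim s)
        have "(\<lambda>N. s + \<delta> N * aN N) \<longlonglongrightarrow> s + 0" "(\<lambda>N. s - \<delta> N * aN N) \<longlonglongrightarrow> s - 0"
          by (intro tendsto_intros \<delta>a)+
        then have "(\<lambda>N. g (s + \<delta> N * aN N) - g (s - \<delta> N * aN N)) \<longlonglongrightarrow> g s - g s"
          using elim by (intro tendsto_diff isCont_tendsto_compose[of _ g]) auto
        then show ?case by simp
      qed
    qed simp_all
    then show ?thesis
      unfolding q_def G_def by (simp add: algebra_simps)
  qed
  \<comment> \<open>The bound of \<open>prod_integral_bound\<close> with
    \<open>1 / \<theta>\<^sup>2 = N powr (1 / 6)\<close>, regrouped in terms of \<open>N * p\<close>
    and \<open>N * q\<close>, whose limits are known. The four terms are the joint exceedances of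
    near pairs, their independent counterpart, the windows of far pairs, and the exceptional large
    moves.\<close>
  define err where "err N = real N powr (7 / 6) * exp (- 2 * (aN N - K / aN N)\<^sup>2 / 3)
      + real N powr (- 5 / 6) * (real N * p N)\<^sup>2 + (real N * p N) * (real N * q N)
      + 4 * ((real N)\<^sup>2 * exp (- (\<delta> N)\<^sup>2 / (8 * (\<theta> N)\<^sup>2)))" for N
  have "err \<longlonglongrightarrow> 0 + 0 * l\<^sup>2 + l * 0 + 4 * 0"
    unfolding err_def
  proof (intro tendsto_add tendsto_mult tendsto_const tendsto_power Np Nq near_pairs_negligible)
    show "(\<lambda>N. real N powr (- 5 / 6)) \<longlonglongrightarrow> 0" by real_asymp
    have "(\<lambda>N. (real N)\<^sup>2 * exp (- (\<delta> N)\<^sup>2 / (8 * (\<theta> N)\<^sup>2))) \<longlonglongrightarrow> 0"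
      unfolding \<delta>_def \<theta>_def by real_asymp
    then show "(\<lambda>N. (real N)\<^sup>2 * exp (- (\<delta> N)\<^sup>2 / (8 * (\<theta> N)\<^sup>2))) \<longlonglongrightarrow> 0" .
  qed
  then have err: "err \<longlonglongrightarrow> 0" by simp
  have "filterlim (\<lambda>N. aN N - K / aN N) at_top sequentially"
    unfolding aN_def by real_asymp
  then have "\<forall>\<^sub>F N in sequentially. 0 \<le> aN N - K / aN N"
    by (simp only: filterlim_at_top)
  moreover have "\<forall>\<^sub>F N in sequentially. 0 < aN N"
    using aN_at_top by (simp add: filterlim_at_top_dense)
  ultimately have "\<forall>\<^sub>F N in sequentially.
      norm ((\<integral>\<omega>. (\<Prod>i\<in>S N. 1 - G N (Z i \<omega>)) \<partial>M) - (1 - p N) ^ N) \<le> err N"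
    using eventually_ge_at_top[of 1]
  proof eventually_elim
    case (elim N)
    have \<theta>: "0 < \<theta> N" "\<theta> N \<le> 1" and \<delta>: "0 < \<delta> N"
      using elim powr_mono[of "- 1 / 12" 0 "real N"] by (auto simp: \<theta>_def \<delta>_def)
    have "\<bar>(\<integral>\<omega>. (\<Prod>i\<in>S N. 1 - G N (Z i \<omega>)) \<partial>M) - (1 - (\<integral>z. G N z \<partial>N01)) ^ N\<bar> \<le>
      real N * (1 / (\<theta> N)\<^sup>2 * (exp (- 2 * (aN N - K / aN N)\<^sup>2 / 3) + (\<integral>z. G N z \<partial>N01)\<^sup>2) +
      real N * ((\<integral>z. G N z \<partial>N01) * (\<integral>z. G N (z + \<delta> N) - G N (z - \<delta> N) \<partial>N01) + 4 * exp (- (\<delta> N)\<^sup>2 / (8 * (\<theta> N)\<^sup>2))))"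
    proof (rule prod_integral_bound[OF S(1) S(2)])
      show "mono (G N)"
        unfolding G_def using elim by (intro monoI monoD[OF mono]) (simp add: mult_right_mono)
      show "G N z = 0" if "z < aN N - K / aN N" for z
      proof -
        have "(z - aN N) * aN N < - K" using that elim by (simp add: field_simps)
        then show ?thesis unfolding G_def by (rule K)
      qed
    qed (use \<theta> \<delta> elim half near G01 in auto)
    also have "\<dots> = err N"
    proof -
      have N: "real N > 0" using elim by simp
      have "1 / (\<theta> N)\<^sup>2 = real N powr (1 / 6)"
        using N by (simp add: \<theta>_def power2_eq_square powr_add[symmetric] powr_minus_divide)
      moreover have "real N * real N powr (1 / 6) = real N powr (7 / 6)"
        using N powr_mult_base[of "real N" "1 / 6"] by simp
      moreover have "real N powr (7 / 6) = real N powr (- 5 / 6) * (real N)\<^sup>2"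
        using N by (simp add: powr_add[symmetric] flip: powr_numeral)
      moreover have "n * (s * (E + x\<^sup>2) + n * (x * y + 4 * F)) =
          t * E + w * (n * x)\<^sup>2 + (n * x) * (n * y) + 4 * (n\<^sup>2 * F)"
        if "n * s = t" "t = w * n\<^sup>2" for n s t w E F x y :: real
        using that by algebra
      ultimately show ?thesis
        unfolding err_def p_def[symmetric] q_def[symmetric] by simp
    qed
    finally show ?case unfolding p_def by simp
  qed
  from Lim_null_comparison[OF this err]
  have "(\<lambda>N. ((\<integral>\<omega>. (\<Prod>i\<in>S N. 1 - G N (Z i \<omega>)) \<partial>M) - (1 - p N) ^ N) + (1 - p N) ^ N) \<longlonglongrightarrow> 0 + exp (- l)"
    by (intro tendsto_add power_one_minus_tendsto_exp p0 p1 Np)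
  then show ?thesis unfolding G_def l_def by simp
qed

section \<open>The regular tree\<close>

locale regular_tree =
  fixes r :: nat and adj :: "'v \<Rightarrow> 'v \<Rightarrow> bool"
  assumes r3: "r \<ge> 3" and tree: "infinite_regular_tree r adj"
begin

lemma adj_sym: "adj x y \<Longrightarrow> adj y x"
  and neighbours: "finite {y. adj x y}" "card {y. adj x y} = r"
  and connected: "adj\<^sup>*\<^sup>* x y"
  using tree unfolding infinite_regular_tree_def by auto

lemma graph_dist_relpowp: "(adj ^^ graph_dist adj x y) x y"
proof -
  obtain n where "(adj ^^ n) x y" using connected[of x y] rtranclp_imp_relpowp by metis
  then show ?thesis unfolding graph_dist_def by (rule LeastI)
qed

lemma graph_dist_le: "(adj ^^ n) x y \<Longrightarrow> graph_dist adj x y \<le> n"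
  unfolding graph_dist_def by (rule Least_le)

lemma relpowp_sym: "(adj ^^ n) x y \<Longrightarrow> (adj ^^ n) y x"
proof (induction n arbitrary: y)
  case (Suc n)
  then obtain z where "(adj ^^ n) x z" "adj z y" by auto
  then show ?case using Suc.IH adj_sym by (metis relpowp_Suc_I2)
qed auto

lemma graph_dist_sym: "graph_dist adj x y = graph_dist adj y x"
  by (rule antisym; rule graph_dist_le, rule relpowp_sym, rule graph_dist_relpowp)

lemma graph_dist_refl: "graph_dist adj x x = 0"
  using graph_dist_le[of 0 x x] by simp

lemma graph_dist_pos: "x \<noteq> y \<Longrightarrow> 1 \<le> graph_dist adj x y"
  using graph_dist_relpowp[of x y] by (cases "graph_dist adj x y") auto

text \<open>Each larger ball is covered by the closed neighbourhoods, of \<open>r + 1\<close> points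
  each, of the points of the smaller one. This overestimates the growth, but any exponential rate
  leads to a polynomial bound in \<open>1 / \<theta>\<close>.\<close>

lemma ball_bound:
  "finite {y. graph_dist adj x y \<le> m} \<and> card {y. graph_dist adj x y \<le> m} \<le> (r + 1) ^ m"
proof (induction m)
  case 0
  have "{y. graph_dist adj x y \<le> 0} \<subseteq> {x}" using graph_dist_pos[of x] by fastforce
  then show ?case using card_mono[of "{x}"] finite_subset by fastforce
next
  case (Suc m)
  let ?B = "{y. graph_dist adj x y \<le> m}"
  let ?U = "\<Union>z\<in>?B. insert z {y. adj z y}"
  have sub: "{y. graph_dist adj x y \<le> Suc m} \<subseteq> ?U"
  proof
    fix y assume "y \<in> {y. graph_dist adj x y \<le> Suc m}"
    then have y: "graph_dist adj x y \<le> Suc m" by simp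
    show "y \<in> ?U"
    proof (cases "graph_dist adj x y \<le> m")
      case False
      with y have "(adj ^^ Suc m) x y" using graph_dist_relpowp[of x y] by (simp add: le_Suc_eq)
      then obtain z where "(adj ^^ m) x z" "adj z y" by auto
      then show ?thesis using graph_dist_le[of m x z] by auto
    qed auto
  qed
  have fin: "finite ?U" using Suc neighbours(1) by auto
  have "card (insert z {y. adj z y}) \<le> r + 1" for z
    using card_insert_le_m1[of "r + 1" "{y. adj z y}" z] neighbours(2)[of z] by simp
  then have "card ?U \<le> (\<Sum>z\<in>?B. r + 1)"
    using Suc by (intro order_trans[OF card_UN_le] sum_mono) auto
  also have "\<dots> = card ?B * (r + 1)" by (simp only: sum_constant of_nat_id)
  also have "\<dots> \<le> (r + 1) ^ m * (r + 1)" using Suc by (intro mult_right_mono) auto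
  finally have "card ?U \<le> (r + 1) ^ Suc m" by (simp only: power_Suc2)
  then show ?case using finite_subset[OF sub fin] order_trans[OF card_mono[OF fin sub]] by blast
qed

text \<open>The Green function divided by its value on the diagonal, hence the correlation of the
  field.\<close>

definition green_corr :: "'v \<Rightarrow> 'v \<Rightarrow> real" where
  "green_corr x y = (1 / (real r - 1)) ^ graph_dist adj x y"

lemma green_corr_le_half: "x \<noteq> y \<Longrightarrow> green_corr x y \<le> 1 / 2"
proof -
  assume "x \<noteq> y"
  then have "green_corr x y \<le> (1 / (real r - 1)) ^ 1"
    unfolding green_corr_def using r3 graph_dist_pos by (intro power_decreasing) auto
  also have "\<dots> \<le> 1 / 2" using r3 by (simp add: field_simps)
  finally show ?thesis .
qed

text \<open>Balls of radius \<open>m\<close> have at most \<open>(r + 1) ^ m \<le> (r - 1) ^ (2 * m)\<close> points, because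
  \<open>r \<ge> 3\<close>: few vertices are strongly correlated with a given one.\<close>

lemma green_corr_near:
  assumes "0 < \<theta>" "\<theta> \<le> 1"
  shows "finite {i. \<theta> \<le> green_corr i k}" "real (card {i. \<theta> \<le> green_corr i k}) \<le> 1 / \<theta>\<^sup>2"
proof -
  \<comment> \<open>The distances at which the correlation is still at least
    \<open>\<theta>\<close>; their maximum is the radius of the ball to be counted. The bound
    \<open>\<theta> \<le> 1\<close> puts \<open>0\<close> among them.\<close>
  let ?D = "{n. (real r - 1) ^ n \<le> 1 / \<theta>}"
  have r2: "real r - 1 \<ge> 2" using r3 by simp
  have finD: "finite ?D"
  proof (rule finite_subset)
    show "?D \<subseteq> {..nat \<lceil>1 / \<theta>\<rceil>}"
    proof
      fix n assume "n \<in> ?D"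
      then have "(real r - 1) ^ n \<le> 1 / \<theta>" by simp
      moreover have "(2::real) ^ n \<le> (real r - 1) ^ n" using r2 by (intro power_mono) auto
      moreover have "real n < 2 ^ n" using of_nat_less_two_power[of n] by simp
      ultimately have "real n \<le> 1 / \<theta>" by linarith
      then have "real n \<le> of_int \<lceil>1 / \<theta>\<rceil>" using le_of_int_ceiling[of "1 / \<theta>"] by linarith
      then show "n \<in> {..nat \<lceil>1 / \<theta>\<rceil>}" by simp
    qed
  qed simp
  have "0 \<in> ?D" using assms by simp
  define m where "m = Max ?D"
  have "m \<in> ?D" unfolding m_def using \<open>0 \<in> ?D\<close> by (intro Max_in finD) blast
  then have m: "(real r - 1) ^ m \<le> 1 / \<theta>" by simp
  have sub: "{i. \<theta> \<le> green_corr i k} \<subseteq> {i. graph_dist adj k i \<le> m}"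
  proof safe
    fix i assume "\<theta> \<le> green_corr i k"
    then have "\<theta> \<le> 1 / (real r - 1) ^ graph_dist adj i k"
      unfolding green_corr_def by (simp add: power_one_over)
    then have "(real r - 1) ^ graph_dist adj i k \<le> 1 / \<theta>"
      using r2 assms by (simp add: field_simps)
    then show "graph_dist adj k i \<le> m"
      unfolding m_def using finD by (intro Max_ge) (auto simp: graph_dist_sym[of k])
  qed
  show "finite {i. \<theta> \<le> green_corr i k}" by (rule finite_subset[OF sub conjunct1[OF ball_bound]])
  have "card {i. \<theta> \<le> green_corr i k} \<le> (r + 1) ^ m"
    using card_mono[OF conjunct1[OF ball_bound] sub] conjunct2[OF ball_bound] by (rule order_trans)
  then have "real (card {i. \<theta> \<le> green_corr i k}) \<le> (real r + 1) ^ m"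
    by (metis of_nat_1 of_nat_add of_nat_le_iff of_nat_power)
  also have "\<dots> \<le> ((real r - 1)\<^sup>2) ^ m"
  proof (rule power_mono)
    have "0 \<le> real r * (real r - 3)" using r3 by (intro mult_nonneg_nonneg) auto
    then show "real r + 1 \<le> (real r - 1)\<^sup>2" by (simp add: power2_eq_square algebra_simps)
  qed simp
  also have "\<dots> = ((real r - 1) ^ m)\<^sup>2" by (simp add: power_mult[symmetric] mult.commute)
  also have "\<dots> \<le> (1 / \<theta>)\<^sup>2" using m r2 by (intro power_mono) auto
  finally show "real (card {i. \<theta> \<le> green_corr i k}) \<le> 1 / \<theta>\<^sup>2" by (simp add: power_divide)
qed

end

text \<open>Since the value \<open>e\<close> is real, the sine integral vanishes and the phase
  contributes only \<open>cos \<alpha>\<close>. The argument \<open>1\<close> is enough because the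
  coefficients of a linear combination absorb any scale.\<close>

lemma (in prob_space) cos_of_char:
  assumes [measurable]: "X \<in> borel_measurable M"
    and char: "char (distr M borel X) 1 = complex_of_real e"
  shows "(\<integral>\<omega>. cos (X \<omega> + \<alpha>) \<partial>M) = cos \<alpha> * e"
proof -
  have i: "integrable M (\<lambda>\<omega>. iexp (X \<omega>))"
    by (rule integrable_const_bound[where B=1]) auto
  have "(\<integral>\<omega>. iexp (X \<omega>) \<partial>M) = complex_of_real e"
    using char unfolding char_def by (simp add: integral_distr)
  then have "(\<integral>\<omega>. cos (X \<omega>) \<partial>M) = e" "(\<integral>\<omega>. sin (X \<omega>) \<partial>M) = 0"
    using integral_Re[OF i] integral_Im[OF i] by (simp_all add: Re_exp Im_exp)
  moreover have "integrable M (\<lambda>\<omega>. cos (X \<omega>))" "integrable M (\<lambda>\<omega>. sin (X \<omega>))"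
    by (rule integrable_const_bound[where B=1]; simp)+
  ultimately show ?thesis by (simp add: cos_add)
qed

lemma (in regular_tree) gaussian_field_normalised:
  assumes gff: "centred_gaussian_field M psi (tree_green r adj)"
  shows "gaussian_field M (\<lambda>x \<omega>. psi x \<omega> / sqrt ((real r - 1) / (real r - 2))) green_corr"
proof -
  interpret prob_space M using gff unfolding centred_gaussian_field_def by blast
  have [measurable]: "psi x \<in> borel_measurable M" for x
    using gff unfolding centred_gaussian_field_def by blast
  define \<sigma> where "\<sigma> = sqrt ((real r - 1) / (real r - 2))"
  have s2: "\<sigma>\<^sup>2 = (real r - 1) / (real r - 2)" and s0: "\<sigma> > 0"
    using r3 unfolding \<sigma>_def by auto
  show ?thesis
    unfolding \<sigma>_def[symmetric]
  proof
    show "(\<lambda>\<omega>. psi x \<omega> / \<sigma>) \<in> borel_measurable M" for x by measurable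
    show "green_corr x x = 1" "green_corr x y = green_corr y x" "0 \<le> green_corr x y" for x y
      using r3 by (auto simp: green_corr_def graph_dist_refl graph_dist_sym[of x])
    fix S :: "'v set" and c \<alpha> assume S: "finite S"
    have "char (distr M borel (\<lambda>\<omega>. \<Sum>x\<in>S. (c x / \<sigma>) * psi x \<omega>)) 1 =
        exp (- complex_of_real ((\<Sum>x\<in>S. \<Sum>y\<in>S. (c x / \<sigma>) * (c y / \<sigma>) * tree_green r adj x y) * 1\<^sup>2 / 2))"
      using gff S unfolding centred_gaussian_field_def
      by (elim conjE allE[of _ S] allE[of _ "\<lambda>x. c x / \<sigma>"] allE[of _ "1::real"]) simp
    also have "(\<Sum>x\<in>S. \<Sum>y\<in>S. (c x / \<sigma>) * (c y / \<sigma>) * tree_green r adj x y) =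
        (\<Sum>x\<in>S. \<Sum>y\<in>S. c x * c y * green_corr x y)"
    proof (intro sum.cong refl)
      fix x y
      have "tree_green r adj x y = \<sigma>\<^sup>2 * green_corr x y"
        unfolding tree_green_def green_corr_def s2 ..
      then show "(c x / \<sigma>) * (c y / \<sigma>) * tree_green r adj x y = c x * c y * green_corr x y"
        using s0 by (simp add: power2_eq_square)
    qed
    finally have "char (distr M borel (\<lambda>\<omega>. \<Sum>x\<in>S. c x * (psi x \<omega> / \<sigma>))) 1 =
        complex_of_real (exp (- (\<Sum>x\<in>S. \<Sum>y\<in>S. c x * c y * green_corr x y) / 2))"
      by (simp add: exp_of_real[symmetric])
    then show "(\<integral>\<omega>. cos ((\<Sum>x\<in>S. c x * (psi x \<omega> / \<sigma>)) + \<alpha>) \<partial>M) =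
        cos \<alpha> * exp (- (\<Sum>x\<in>S. \<Sum>y\<in>S. c x * c y * green_corr x y) / 2)"
      by (intro cos_of_char) simp_all
  qed
qed

section \<open>Poisson processes\<close>

text \<open>With \<open>exp_neg \<infinity> = 0\<close> the Laplace functional also encodes void probabilities.\<close>

definition exp_neg :: "ennreal \<Rightarrow> real" where
  "exp_neg x = (if x = \<infinity> then 0 else exp (- enn2real x))"

lemma exp_neg_0[simp]: "exp_neg 0 = 1"
  and exp_neg_infinity[simp]: "exp_neg \<infinity> = 0"
  and exp_neg_top[simp]: "exp_neg \<top> = 0"
  by (simp_all add: exp_neg_def infinity_ennreal_def)

lemma exp_neg_ennreal: "0 \<le> x \<Longrightarrow> exp_neg (ennreal x) = exp (- x)"
  by (simp add: exp_neg_def)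

lemma exp_neg_nonneg[simp]: "0 \<le> exp_neg x" and exp_neg_le_1[simp]: "exp_neg x \<le> 1"
  by (simp_all add: exp_neg_def)

lemma exp_neg_measurable[measurable]: "exp_neg \<in> borel_measurable borel"
  unfolding exp_neg_def by measurable

lemma exp_neg_add: "exp_neg (x + y) = exp_neg x * exp_neg y"
  by (cases x rule: ennreal_cases; cases y rule: ennreal_cases)
     (auto simp: exp_neg_ennreal exp_add[symmetric] simp flip: ennreal_plus)

lemma exp_neg_sum: "finite I \<Longrightarrow> exp_neg (\<Sum>i\<in>I. f i) = (\<Prod>i\<in>I. exp_neg (f i))"
  by (induction I rule: finite_induct) (auto simp: exp_neg_add)

lemma exp_neg_mult_of_nat: "exp_neg (c * of_nat k) = exp_neg c ^ k"
  by (induction k) (auto simp: exp_neg_add distrib_left)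

text \<open>As \<open>enn2real\<close> sends \<open>\<infinity>\<close> to \<open>0\<close>,
  continuity at \<open>\<infinity>\<close> is not inherited from it and is proved directly.\<close>

lemma tendsto_exp_neg:
  fixes f :: "nat \<Rightarrow> ennreal"
  assumes "f \<longlonglongrightarrow> x"
  shows "(\<lambda>n. exp_neg (f n)) \<longlonglongrightarrow> exp_neg x"
proof (cases x rule: ennreal_cases)
  case (real r)
  have "\<forall>\<^sub>F n in sequentially. f n < \<top>"
    using assms real by (intro order_tendstoD(2)[of f x]) auto
  then have "\<forall>\<^sub>F n in sequentially. exp (- enn2real (f n)) = exp_neg (f n)"
    by eventually_elim (auto simp: exp_neg_def)
  moreover have "(\<lambda>n. exp (- enn2real (f n))) \<longlonglongrightarrow> exp (- r)"
    using assms real by (intro tendsto_intros tendsto_enn2real) auto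
  ultimately show ?thesis
    using real by (simp add: exp_neg_ennreal Lim_transform_eventually)
next
  case top
  show ?thesis
    unfolding top exp_neg_top
  proof (rule LIMSEQ_I)
    fix \<epsilon> :: real assume \<epsilon>: "0 < \<epsilon>"
    \<comment> \<open>Beyond \<open>- ln \<epsilon>\<close> the exponential is below
      \<open>\<epsilon>\<close>; the maximum with \<open>0\<close> keeps \<open>ennreal\<close> from
      truncating a negative bound.\<close>
    define B where "B = max 0 (- ln \<epsilon>)"
    have "\<forall>\<^sub>F n in sequentially. ennreal B < f n"
      using assms top by (intro order_tendstoD(1)[of f x]) auto
    then obtain n0 where n0: "\<And>n. n \<ge> n0 \<Longrightarrow> ennreal B < f n"
      unfolding eventually_sequentially by blast
    have "norm (exp_neg (f n) - 0) < \<epsilon>" if "n \<ge> n0" for n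
    proof (cases "f n" rule: ennreal_cases)
      case (real y)
      have "B < y" using n0[OF that] ennreal_less_iff[of B y] real by (simp add: B_def)
      then have "- y < ln \<epsilon>" unfolding B_def by simp
      then have "exp (- y) < \<epsilon>" using \<epsilon> by (metis exp_less_cancel_iff exp_ln)
      then show ?thesis using real by (simp add: exp_neg_ennreal)
    qed (use \<epsilon> in simp)
    then show "\<exists>no. \<forall>n\<ge>no. norm (exp_neg (f n) - 0) < \<epsilon>" by blast
  qed
qed

section \<open>Laplace functional of the Poisson process\<close>

locale poisson_exp = prob_space L for L :: "'b measure" +
  fixes Pp :: "'b \<Rightarrow> real measure"
  assumes ppp: "is_PPP_exp L Pp"
begin

lemma sets_Pp[simp]: "sets (Pp \<omega>) = sets borel"
  by (rule ppp[unfolded is_PPP_exp_def, THEN conjunct2, THEN conjunct1, rule_format])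

lemma space_Pp[simp]: "space (Pp \<omega>) = UNIV"
  using sets_eq_imp_space_eq[OF sets_Pp] by simp

lemma borel_measurable_Pp[simp]: "f \<in> borel_measurable (Pp \<omega>) \<longleftrightarrow> f \<in> borel_measurable borel"
  by (simp add: measurable_cong_sets[OF sets_Pp refl])

lemma count_measurable: "A \<in> sets borel \<Longrightarrow> (\<lambda>\<omega>. emeasure (Pp \<omega>) A) \<in> borel_measurable L"
  by (rule ppp[unfolded is_PPP_exp_def, THEN conjunct2, THEN conjunct2, THEN conjunct1, rule_format])

lemma count_distribution:
  assumes "A \<in> sets borel" "bounded A"
  shows "prob {\<omega>\<in>space L. emeasure (Pp \<omega>) A = of_nat k} = exp (- intensity_exp A) * intensity_exp A ^ k / fact k"
  using ppp[unfolded is_PPP_exp_def, THEN conjunct2, THEN conjunct2, THEN conjunct2, THEN conjunct1] assms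
  by simp

lemma count_independent:
  fixes A :: "nat \<Rightarrow> real set"
  assumes "finite I" "\<And>i. i \<in> I \<Longrightarrow> A i \<in> sets borel" "\<And>i. i \<in> I \<Longrightarrow> bounded (A i)" "disjoint_family_on A I"
  shows "indep_vars (\<lambda>_. borel) (\<lambda>i \<omega>. emeasure (Pp \<omega>) (A i)) I"
  using ppp[unfolded is_PPP_exp_def, THEN conjunct2, THEN conjunct2, THEN conjunct2, THEN conjunct2] assms
  by simp

text \<open>This is the generating function of the Poisson law at \<open>exp_neg c\<close>. It
  includes \<open>c = \<infinity>\<close>, where \<open>\<infinity> * 0 = 0\<close> matches
  \<open>0 ^ 0 = 1\<close> and the void probability results.\<close>

lemma laplace_count:
  assumes A: "A \<in> sets borel" "bounded A"
  shows "(\<integral>\<omega>. exp_neg (c * emeasure (Pp \<omega>) A) \<partial>L) = exp (- ((1 - exp_neg c) * intensity_exp A))"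
proof -
  define X where "X \<omega> = emeasure (Pp \<omega>) A" for \<omega>
  have [measurable]: "X \<in> borel_measurable L" unfolding X_def using A(1) by (rule count_measurable)
  define l where "l = intensity_exp A"
  define E where "E k = {\<omega>\<in>space L. X \<omega> = of_nat k}" for k :: nat
  have E[measurable]: "E k \<in> sets L" for k unfolding E_def by measurable
  have pE: "prob (E k) = exp (- l) * l ^ k / fact k" for k
    unfolding E_def X_def l_def by (rule count_distribution[OF A])
  have exp_sums: "(\<lambda>k. exp (- l) * (t * l) ^ k / fact k) sums (exp (- l) * exp (t * l))" for t :: real
    using sums_mult[OF exp_converges[of "t * l"], of "exp (- l)"]
    by (simp add: field_simps)
  \<comment> \<open>The Poisson weights already add up to one, so almost surely the count is a
    natural number.\<close>
  have "AE \<omega> in L. \<omega> \<in> (\<Union>k. E k)"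
  proof -
    have "prob (\<Union>k. E k) = 1"
    proof -
      have "(\<lambda>k. prob (E k)) sums prob (\<Union>k. E k)"
        by (rule finite_measure_UNION) (auto simp: disjoint_family_on_def E_def)
      moreover have "(\<lambda>k. prob (E k)) sums 1"
        using exp_sums[of 1] unfolding pE by (simp add: exp_add[symmetric])
      ultimately show ?thesis by (rule sums_unique2)
    qed
    then show ?thesis by (intro AE_prob_1) auto
  qed
  then have nat: "AE \<omega> in L. \<exists>j. X \<omega> = of_nat j \<and> \<omega> \<in> space L"
    by eventually_elim (auto simp: E_def)
  \<comment> \<open>On \<open>X = j\<close> the partial sums are \<open>0\<close> up to
    \<open>n = j\<close> and constant afterwards, hence bounded by 1.\<close>
  define F where "F n \<omega> = (\<Sum>k<n. exp_neg c ^ k * indicator (E k) \<omega>)" for n :: nat and \<omega>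
  have F: "F n \<omega> = (if j < n then exp_neg c ^ j else 0)" if "X \<omega> = of_nat j" "\<omega> \<in> space L" for n \<omega> j
  proof -
    have "F n \<omega> = (\<Sum>k<n. if k = j then exp_neg c ^ k else 0)"
      unfolding F_def using that by (intro sum.cong) (auto simp: E_def indicator_def)
    then show ?thesis by simp
  qed
  have "(\<lambda>n. \<integral>\<omega>. F n \<omega> \<partial>L) \<longlonglongrightarrow> (\<integral>\<omega>. exp_neg (c * X \<omega>) \<partial>L)"
  proof (rule integral_dominated_convergence[where w="\<lambda>_. 1"])
    show "AE \<omega> in L. (\<lambda>n. F n \<omega>) \<longlonglongrightarrow> exp_neg (c * X \<omega>)"
      using nat
    proof eventually_elim
      case (elim \<omega>)
      then obtain j where j: "X \<omega> = of_nat j" "\<omega> \<in> space L" by blast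
      show ?case
        unfolding j(1) exp_neg_mult_of_nat
        by (rule tendsto_eventually, rule eventually_sequentiallyI[of "Suc j"]) (simp add: F[OF j])
    qed
    show "AE \<omega> in L. norm (F n \<omega>) \<le> 1" for n
      using nat
    proof eventually_elim
      case (elim \<omega>)
      then obtain j where j: "X \<omega> = of_nat j" "\<omega> \<in> space L" by blast
      show ?case by (simp add: F[OF j] power_le_one)
    qed
  qed (unfold F_def, measurable)
  moreover have "(\<integral>\<omega>. F n \<omega> \<partial>L) = (\<Sum>k<n. exp (- l) * (exp_neg c * l) ^ k / fact k)" for n
    unfolding F_def
    by (subst Bochner_Integration.integral_sum)
       (auto simp: pE power_mult_distrib less_top[symmetric] intro!: sum.cong integrable_mult_right)
  moreover have "(\<lambda>n. \<Sum>k<n. exp (- l) * (exp_neg c * l) ^ k / fact k) \<longlonglongrightarrow> exp (- l) * exp (exp_neg c * l)"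
    using exp_sums[of "exp_neg c"] unfolding sums_def .
  ultimately have "(\<integral>\<omega>. exp_neg (c * X \<omega>) \<partial>L) = exp (- l) * exp (exp_neg c * l)"
    by (simp add: LIMSEQ_unique)
  then show ?thesis
    unfolding X_def l_def by (simp add: exp_add[symmetric] algebra_simps)
qed

lemma laplace_sum:
  fixes A :: "nat \<Rightarrow> real set"
  assumes A: "\<And>i. i < n \<Longrightarrow> A i \<in> sets borel" "\<And>i. i < n \<Longrightarrow> bounded (A i)" "disjoint_family_on A {..<n}"
  shows "(\<integral>\<omega>. exp_neg (\<Sum>i<n. c i * emeasure (Pp \<omega>) (A i)) \<partial>L) =
    exp (- (\<Sum>i<n. (1 - exp_neg (c i)) * intensity_exp (A i)))"
proof -
  have "(\<integral>\<omega>. exp_neg (\<Sum>i<n. c i * emeasure (Pp \<omega>) (A i)) \<partial>L) =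
     (\<integral>\<omega>. (\<Prod>i<n. exp_neg (c i * emeasure (Pp \<omega>) (A i))) \<partial>L)"
    by (simp add: exp_neg_sum)
  also have "\<dots> = (\<Prod>i<n. \<integral>\<omega>. exp_neg (c i * emeasure (Pp \<omega>) (A i)) \<partial>L)"
  proof (rule indep_vars_lebesgue_integral)
    show "indep_vars (\<lambda>_. borel) (\<lambda>i \<omega>. exp_neg (c i * emeasure (Pp \<omega>) (A i))) {..<n}"
      by (rule indep_vars_compose2[OF count_independent[of "{..<n}" A], where Y="\<lambda>i x. exp_neg (c i * x)"])
         (use A in auto)
    show "integrable L (\<lambda>\<omega>. exp_neg (c i * emeasure (Pp \<omega>) (A i)))" if "i \<in> {..<n}" for i
    proof -
      have [measurable]: "(\<lambda>\<omega>. emeasure (Pp \<omega>) (A i)) \<in> borel_measurable L"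
        using A that by (intro count_measurable) auto
      show ?thesis by (rule integrable_const_bound[where B=1]) auto
    qed
  qed simp
  also have "\<dots> = (\<Prod>i<n. exp (- ((1 - exp_neg (c i)) * intensity_exp (A i))))"
    using A by (intro prod.cong laplace_count) auto
  also have "\<dots> = exp (- (\<Sum>i<n. (1 - exp_neg (c i)) * intensity_exp (A i)))"
    by (simp add: exp_sum sum_negf[symmetric])
  finally show ?thesis .
qed

text \<open>The laws and the independence of the counts are given for bounded sets only. Hence the
  bounded support, and hence the removal of the value \<open>0\<close>, the only one whose level set
  is unbounded.\<close>

lemma laplace_simple:
  fixes h :: "real \<Rightarrow> ennreal"
  assumes h: "simple_function borel h" and bd: "\<And>s. h s \<noteq> 0 \<Longrightarrow> \<bar>s\<bar> \<le> B"
  shows "(\<lambda>\<omega>. \<integral>\<^sup>+s. h s \<partial>Pp \<omega>) \<in> borel_measurable L" (is ?meas)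
    and "(\<integral>\<omega>. exp_neg (\<integral>\<^sup>+s. h s \<partial>Pp \<omega>) \<partial>L) = exp (- (\<integral>s. (1 - exp_neg (h s)) * exp (- s) \<partial>lborel))" (is ?lap)
proof -
  let ?R = "range h - {0}"
  have fin: "finite (range h)" using h by (simp add: simple_function_def)
  have hm: "h -` {v} \<in> sets borel" for v
    using measurable_sets[OF borel_measurable_simple_function[OF h], of "{v}"] by simp
  define n where "n = card ?R"
  obtain y where y: "bij_betw y {..<n} ?R"
    using ex_bij_betw_nat_finite[of ?R] fin unfolding n_def atLeast0LessThan by auto
  define A where "A k = h -` {y k}" for k
  have A[measurable]: "A k \<in> sets borel" for k unfolding A_def by (rule hm)
  have bdA: "bounded (A k)" if "k < n" for k
  proof -
    have "y k \<noteq> 0" using y that by (auto dest: bij_betwE)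
    have "A k \<subseteq> {- B..B}"
    proof
      fix s assume "s \<in> A k"
      then have "\<bar>s\<bar> \<le> B" using \<open>y k \<noteq> 0\<close> by (intro bd) (simp add: A_def)
      then show "s \<in> {- B..B}" by auto
    qed
    then show ?thesis using bounded_closed_interval bounded_subset by blast
  qed
  have "inj_on y {..<n}" using y by (simp add: bij_betw_def)
  then have disj: "disjoint_family_on A {..<n}"
    unfolding disjoint_family_on_def A_def by (auto dest: inj_onD)
  have int: "(\<integral>\<^sup>+s. h s \<partial>Pp \<omega>) = (\<Sum>k<n. y k * emeasure (Pp \<omega>) (A k))" for \<omega>
  proof -
    have "simple_function (Pp \<omega>) h"
      using h simple_function_cong_algebra[of "Pp \<omega>" borel h] by simp
    then have "(\<integral>\<^sup>+s. h s \<partial>Pp \<omega>) = (\<Sum>v\<in>range h. v * emeasure (Pp \<omega>) (h -` {v}))"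
      by (simp add: nn_integral_eq_simple_integral simple_integral_def)
    also have "\<dots> = (\<Sum>v\<in>?R. v * emeasure (Pp \<omega>) (h -` {v}))"
      using fin by (intro sum.mono_neutral_right) auto
    also have "\<dots> = (\<Sum>k<n. y k * emeasure (Pp \<omega>) (A k))"
      unfolding A_def by (rule sum.reindex_bij_betw[OF y, symmetric])
    finally show ?thesis .
  qed
  have [measurable]: "(\<lambda>\<omega>. emeasure (Pp \<omega>) (A k)) \<in> borel_measurable L" for k
    by (rule count_measurable) simp
  show ?meas unfolding int by measurable
  have iA: "integrable lborel (\<lambda>s. indicator (A k) s * exp (- s))" if k: "k < n" for k
  proof -
    obtain b where b: "\<And>x. x \<in> A k \<Longrightarrow> \<bar>x\<bar> \<le> b" using bdA[OF k] unfolding bounded_iff by auto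
    show ?thesis
      by (rule integrable_exp_bounded[where a="- b" and C=1]) (auto simp: indicator_def dest: b)
  qed
  have pt: "(1 - exp_neg (h s)) * exp (- s) = (\<Sum>k<n. (1 - exp_neg (y k)) * (indicator (A k) s * exp (- s)))" for s
  proof -
    have "(\<Sum>k<n. (1 - exp_neg (y k)) * (indicator (A k) s * exp (- s))) =
        (\<Sum>v\<in>?R. (1 - exp_neg v) * (indicator (h -` {v}) s * exp (- s)))"
      unfolding A_def by (rule sum.reindex_bij_betw[OF y])
    also have "\<dots> = (\<Sum>v\<in>?R. if v = h s then (1 - exp_neg v) * exp (- s) else 0)"
      by (intro sum.cong) (auto simp: indicator_def)
    also have "\<dots> = (1 - exp_neg (h s)) * exp (- s)"
      using fin by (auto simp: sum.delta')
    finally show ?thesis ..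
  qed
  have "(\<integral>s. (1 - exp_neg (h s)) * exp (- s) \<partial>lborel) =
     (\<Sum>k<n. (1 - exp_neg (y k)) * intensity_exp (A k))"
    unfolding pt intensity_exp_def using iA
    by (subst Bochner_Integration.integral_sum) auto
  then show ?lap
    unfolding int using laplace_sum[of n A y] bdA disj by simp
qed

text \<open>Simple functions increasing to \<open>h\<close> are cut off to \<open>[- n, n]\<close>
  to have bounded support. They stay below \<open>h\<close>, so they inherit its vanishing to the
  left of \<open>- K\<close>, and \<open>exp (- s)\<close> on the remaining half-line
  dominates.\<close>

theorem laplace_functional:
  fixes h :: "real \<Rightarrow> ennreal"
  assumes h: "h \<in> borel_measurable borel" and z: "\<And>s. s < - K \<Longrightarrow> h s = 0"
  shows "(\<lambda>\<omega>. \<integral>\<^sup>+s. h s \<partial>Pp \<omega>) \<in> borel_measurable L" (is ?meas)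
    and "(\<integral>\<omega>. exp_neg (\<integral>\<^sup>+s. h s \<partial>Pp \<omega>) \<partial>L) = exp (- (\<integral>s. (1 - exp_neg (h s)) * exp (- s) \<partial>lborel))" (is ?lap)
proof -
  obtain f where f: "\<And>i. simple_function borel (f i)" "incseq f" and sup: "\<And>x. (SUP i. f i x) = h x"
    using borel_measurable_implies_simple_function_sequence'[OF h] by metis
  define H where "H n s = f n s * indicator {- real n..real n} s" for n s
  have sH: "simple_function borel (H n)" for n
    unfolding H_def using f(1) by (intro simple_function_mult simple_function_indicator) auto
  have bH: "\<bar>s\<bar> \<le> real n" if "H n s \<noteq> 0" for n s
    using that unfolding H_def by (auto simp: indicator_def split: if_splits)
  have incH: "incseq H"
    unfolding H_def by (intro incseq_SucI le_funI mult_mono)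
      (auto simp: indicator_def incseq_SucD[OF f(2), THEN le_funD])
  have limH: "(\<lambda>n. H n s) \<longlonglongrightarrow> h s" for s
  proof -
    have "incseq (\<lambda>n. f n s)" using f(2) by (auto simp: incseq_def le_fun_def)
    then have "(\<lambda>n. f n s) \<longlonglongrightarrow> h s" using LIMSEQ_SUP[of "\<lambda>n. f n s"] sup by simp
    moreover have "\<forall>\<^sub>F n in sequentially. f n s = H n s"
      using eventually_ge_at_top[of "nat \<lceil>\<bar>s\<bar>\<rceil>"]
    proof eventually_elim
      case (elim n)
      then have "\<bar>s\<bar> \<le> real n" by linarith
      then show ?case by (auto simp: H_def indicator_def)
    qed
    ultimately show ?thesis by (rule Lim_transform_eventually)
  qed
  have supH: "(SUP n. H n s) = h s" for s
  proof (rule LIMSEQ_unique[OF _ limH])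
    show "(\<lambda>n. H n s) \<longlonglongrightarrow> (SUP n. H n s)"
      using incH by (intro LIMSEQ_SUP) (auto simp: incseq_def le_fun_def)
  qed
  have mH: "H n \<in> borel_measurable borel" for n using sH by (rule borel_measurable_simple_function)
  have lim: "(\<lambda>n. \<integral>\<^sup>+s. H n s \<partial>Pp \<omega>) \<longlonglongrightarrow> (\<integral>\<^sup>+s. h s \<partial>Pp \<omega>)" for \<omega>
  proof -
    have "(\<integral>\<^sup>+s. (SUP n. H n s) \<partial>Pp \<omega>) = (SUP n. \<integral>\<^sup>+s. H n s \<partial>Pp \<omega>)"
      using incH mH by (intro nn_integral_monotone_convergence_SUP) auto
    moreover have "incseq (\<lambda>n. \<integral>\<^sup>+s. H n s \<partial>Pp \<omega>)"
      using incH by (auto simp: incseq_def le_fun_def intro!: nn_integral_mono)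
    ultimately show ?thesis using LIMSEQ_SUP[of "\<lambda>n. \<integral>\<^sup>+s. H n s \<partial>Pp \<omega>"] by (simp add: supH)
  qed
  have [measurable]: "(\<lambda>\<omega>. \<integral>\<^sup>+s. H n s \<partial>Pp \<omega>) \<in> borel_measurable L" for n
    by (rule laplace_simple(1)[OF sH bH])
  show m[measurable]: ?meas
    by (rule borel_measurable_LIMSEQ_order[OF lim]) measurable
  have "(\<lambda>n. \<integral>\<omega>. exp_neg (\<integral>\<^sup>+s. H n s \<partial>Pp \<omega>) \<partial>L) \<longlonglongrightarrow> (\<integral>\<omega>. exp_neg (\<integral>\<^sup>+s. h s \<partial>Pp \<omega>) \<partial>L)"
    by (rule integral_dominated_convergence[where w="\<lambda>_. 1"]) (auto intro!: AE_I2 tendsto_exp_neg lim)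
  moreover have "(\<lambda>n. \<integral>s. (1 - exp_neg (H n s)) * exp (- s) \<partial>lborel) \<longlonglongrightarrow>
      (\<integral>s. (1 - exp_neg (h s)) * exp (- s) \<partial>lborel)"
  proof (rule integral_dominated_convergence[where w="\<lambda>s. indicator {- K..} s * exp (- s)"])
    show "integrable lborel (\<lambda>s. indicator {- K..} s * exp (- s))"
      using has_bochner_integral_exp_atLeast[of "- K"] by (simp add: has_bochner_integral_iff)
    show "AE s in lborel. (\<lambda>n. (1 - exp_neg (H n s)) * exp (- s)) \<longlonglongrightarrow> (1 - exp_neg (h s)) * exp (- s)"
      by (intro AE_I2 tendsto_intros tendsto_exp_neg limH)
    show "AE s in lborel. norm ((1 - exp_neg (H n s)) * exp (- s)) \<le> indicator {- K..} s * exp (- s)" for n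
    proof (rule AE_I2)
      fix s
      have "H n s \<le> h s" unfolding supH[of s, symmetric] by (rule SUP_upper) simp
      then have "s < - K \<Longrightarrow> H n s = 0" using z[of s] by simp
      then show "norm ((1 - exp_neg (H n s)) * exp (- s)) \<le> indicator {- K..} s * exp (- s)"
        by (auto simp: indicator_def abs_mult)
    qed
  qed (use h mH in measurable)
  then have "(\<lambda>n. exp (- (\<integral>s. (1 - exp_neg (H n s)) * exp (- s) \<partial>lborel))) \<longlonglongrightarrow>
      exp (- (\<integral>s. (1 - exp_neg (h s)) * exp (- s) \<partial>lborel))"
    by (intro tendsto_intros)
  moreover have "(\<integral>\<omega>. exp_neg (\<integral>\<^sup>+s. H n s \<partial>Pp \<omega>) \<partial>L) =
      exp (- (\<integral>s. (1 - exp_neg (H n s)) * exp (- s) \<partial>lborel))" for n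
    by (rule laplace_simple(2)[OF sH bH])
  ultimately show ?lap by (simp add: LIMSEQ_unique)
qed

section \<open>Counts on half-lines\<close>

lemma count_right_measurable[measurable]: "(\<lambda>\<omega>. emeasure (Pp \<omega>) {t<..}) \<in> borel_measurable L"
  by (rule count_measurable) simp

text \<open>A half-line is unbounded, so its count is reached through the Laplace functional and not
  through the Poisson law of bounded sets.\<close>

lemma laplace_count_right:
  "(\<integral>\<omega>. exp_neg (c * emeasure (Pp \<omega>) {t<..}) \<partial>L) = exp (- ((1 - exp_neg c) * exp (- t)))"
proof -
  have "(\<integral>\<^sup>+s. c * indicator {t<..} s \<partial>Pp \<omega>) = c * emeasure (Pp \<omega>) {t<..}" for \<omega>
    by (rule nn_integral_cmult_indicator) simp
  then have "(\<integral>\<omega>. exp_neg (c * emeasure (Pp \<omega>) {t<..}) \<partial>L) =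
      exp (- (\<integral>s. (1 - exp_neg (c * indicator {t<..} s)) * exp (- s) \<partial>lborel))"
    using laplace_functional(2)[of "\<lambda>s. c * indicator {t<..} s" "- t"] by simp
  also have "(\<integral>s. (1 - exp_neg (c * indicator {t<..} s)) * exp (- s) \<partial>lborel) =
      (\<integral>s. (1 - exp_neg c) * (indicator {t..} s * exp (- s)) \<partial>lborel)"
  proof (rule integral_cong_AE)
    show "AE s in lborel. (1 - exp_neg (c * indicator {t<..} s)) * exp (- s) =
        (1 - exp_neg c) * (indicator {t..} s * exp (- s))"
      using AE_lborel_singleton[of t] by eventually_elim (auto simp: indicator_def)
  qed simp_all
  also have "\<dots> = (1 - exp_neg c) * exp (- t)"
    using has_bochner_integral_exp_atLeast[of t] by (simp add: has_bochner_integral_iff)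
  finally show ?thesis .
qed

lemma prob_no_points_right:
  "prob {\<omega>\<in>space L. emeasure (Pp \<omega>) {t<..} = 0} = exp (- exp (- t))"
proof -
  have "prob {\<omega>\<in>space L. emeasure (Pp \<omega>) {t<..} = 0} =
      (\<integral>\<omega>. indicator {\<omega>\<in>space L. emeasure (Pp \<omega>) {t<..} = 0} \<omega> \<partial>L)" by simp
  \<comment> \<open>The function \<open>exp_neg (\<infinity> * x)\<close> is the indicator of
    \<open>x = 0\<close>.\<close>
  also have "\<dots> = (\<integral>\<omega>. exp_neg (\<infinity> * emeasure (Pp \<omega>) {t<..}) \<partial>L)"
    by (rule Bochner_Integration.integral_cong) (auto simp: indicator_def ennreal_top_mult)
  finally show ?thesis by (simp add: laplace_count_right)
qed

lemma AE_no_points_far_right: "AE \<omega> in L. \<exists>t. emeasure (Pp \<omega>) {t<..} = 0"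
proof -
  let ?E = "\<lambda>n::nat. {\<omega>\<in>space L. emeasure (Pp \<omega>) {real n<..} = 0}"
  have "(\<lambda>n. exp (- exp (- real n))) \<longlonglongrightarrow> 1" by real_asymp
  moreover have "exp (- exp (- real n)) \<le> prob (\<Union>n. ?E n)" for n
    unfolding prob_no_points_right[symmetric] by (rule finite_measure_mono) auto
  ultimately have "1 \<le> prob (\<Union>n. ?E n)" by (intro LIMSEQ_le_const2) auto
  then have "prob (\<Union>n. ?E n) = 1" using prob_le_1 by (intro antisym) auto
  from AE_prob_1[OF this] show ?thesis by eventually_elim auto
qed

lemma AE_points_far_left: "AE \<omega> in L. \<exists>t. emeasure (Pp \<omega>) {t<..} \<noteq> 0"
proof -
  let ?E = "\<lambda>n::nat. {\<omega>\<in>space L. emeasure (Pp \<omega>) {- real n<..} = 0}"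
  have "(\<lambda>n. exp (- exp (real n))) \<longlonglongrightarrow> 0" by real_asymp
  moreover have "prob (\<Inter>n. ?E n) \<le> exp (- exp (real n))" for n
    using prob_no_points_right[of "- real n"] finite_measure_mono[of "\<Inter>n. ?E n" "?E n"] by auto
  ultimately have "prob (\<Inter>n. ?E n) \<le> 0" by (intro LIMSEQ_le_const) auto
  then have "prob (\<Inter>n. ?E n) = 0" using measure_nonneg by (intro antisym) auto
  then have "AE \<omega> in L. \<omega> \<notin> (\<Inter>n. ?E n)" by (subst (asm) prob_eq_0) auto
  then show ?thesis by (rule AE_mp) (auto intro!: AE_I2)
qed

text \<open>For every \<open>c > 0\<close> the function \<open>exp_neg (c * x)\<close> vanishes at
  \<open>x = \<infinity>\<close>, so its expectation is at most the probability of finiteness; as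
  \<open>c\<close> decreases to \<open>0\<close> this expectation tends to one.\<close>

lemma AE_finite_right: "AE \<omega> in L. emeasure (Pp \<omega>) {t<..} < \<infinity>"
proof -
  let ?E = "{\<omega>\<in>space L. emeasure (Pp \<omega>) {t<..} < \<infinity>}"
  define c where "c n = ennreal (1 / real (Suc n))" for n
  have c: "exp_neg (c n) = exp (- (1 / real (Suc n)))" for n
    unfolding c_def by (rule exp_neg_ennreal) simp
  have "(\<lambda>n. exp (- ((1 - exp (- (1 / real (Suc n)))) * exp (- t)))) \<longlonglongrightarrow> 1" by real_asymp
  moreover have "exp (- ((1 - exp (- (1 / real (Suc n)))) * exp (- t))) \<le> prob ?E" for n
  proof -
    have "exp (- ((1 - exp (- (1 / real (Suc n)))) * exp (- t))) = (\<integral>\<omega>. exp_neg (c n * emeasure (Pp \<omega>) {t<..}) \<partial>L)"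
      unfolding laplace_count_right c ..
    also have "\<dots> \<le> (\<integral>\<omega>. indicator ?E \<omega> \<partial>L)"
    proof (rule integral_mono)
      show "integrable L (\<lambda>\<omega>. exp_neg (c n * emeasure (Pp \<omega>) {t<..}))"
        by (rule integrable_const_bound[where B=1]) auto
      show "integrable L (indicator ?E :: _ \<Rightarrow> real)"
        by (rule integrable_const_bound[where B=1]) auto
      fix \<omega> assume "\<omega> \<in> space L"
      then show "exp_neg (c n * emeasure (Pp \<omega>) {t<..}) \<le> indicator ?E \<omega>"
        by (cases "emeasure (Pp \<omega>) {t<..} = \<top>")
           (auto simp: indicator_def c_def ennreal_mult_top less_top[symmetric])
    qed
    also have "\<dots> = prob ?E" by simp
    finally show ?thesis .
  qed
  ultimately have "1 \<le> prob ?E" by (intro LIMSEQ_le_const2) auto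
  then have "prob ?E = 1" using prob_le_1 by (intro antisym) auto
  from AE_prob_1[OF this] show ?thesis by eventually_elim auto
qed

end

section \<open>The maximum of the Poisson process\<close>

lemma pp_max_le_iff:
  fixes P :: "real measure"
  assumes P: "sets P = sets borel"
    and right: "emeasure P {t<..} = 0" and left: "emeasure P {t'<..} \<noteq> 0"
  shows "pp_max P \<le> a \<longleftrightarrow> emeasure P {a<..} = 0"
proof -
  let ?T = "{t. emeasure P {t<..} = 0}"
  have up: "emeasure P {y<..} = 0" if "emeasure P {x<..} = 0" "x \<le> y" for x y
  proof -
    have "emeasure P {y<..} \<le> emeasure P {x<..}"
      using that(2) P by (intro emeasure_mono) auto
    then show ?thesis using that(1) by simp
  qed
  have bdd: "bdd_below ?T"
  proof
    fix x assume "x \<in> ?T"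
    then show "t' \<le> x" using up[of x t'] left by force
  qed
  show ?thesis
  proof
    assume "emeasure P {a<..} = 0"
    then show "pp_max P \<le> a" unfolding pp_max_def by (intro cInf_lower bdd) simp
  next
    assume le: "pp_max P \<le> a"
    \<comment> \<open>The infimum is attained: levels slightly above \<open>a\<close> carry no
      points to their right, and \<open>{a<..}\<close> is the union of these open
      half-lines.\<close>
    have z: "emeasure P {a + 1 / real (Suc n)<..} = 0" for n
    proof -
      have "Inf ?T < a + 1 / real (Suc n)"
        using le unfolding pp_max_def by (rule order.strict_trans1) simp
      then obtain x where "x \<in> ?T" "x < a + 1 / real (Suc n)"
        using right cInf_lessD[of ?T "a + 1 / real (Suc n)"] by blast
      then show ?thesis using up[of x "a + 1 / real (Suc n)"] by auto
    qed
    have "{a<..} = (\<Union>n. {a + 1 / real (Suc n)<..})"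
    proof safe
      fix x assume "a < x"
      then obtain n where "1 / real (Suc n) < x - a"
        using reals_Archimedean[of "x - a"] by (auto simp: inverse_eq_divide)
      then show "x \<in> (\<Union>n. {a + 1 / real (Suc n)<..})" by (auto intro!: exI[of _ n])
    next
      fix x n assume "a + 1 / real (Suc n) < x"
      then show "a < x" by (rule order.strict_trans[rotated]) simp
    qed
    moreover have "emeasure P (\<Union>n. {a + 1 / real (Suc n)<..}) = 0"
      using z P by (intro emeasure_UN_eq_0) auto
    ultimately show "emeasure P {a<..} = 0" by simp
  qed
qed

context poisson_exp begin

lemma AE_pp_max_le_iff: "AE \<omega> in L. \<forall>a. pp_max (Pp \<omega>) \<le> a \<longleftrightarrow> emeasure (Pp \<omega>) {a<..} = 0"
  using AE_no_points_far_right AE_points_far_left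
  by eventually_elim (use pp_max_le_iff[OF sets_Pp] in blast)

text \<open>On the null event where the set defining \<open>pp_max\<close> is empty or all of \<open>\<real>\<close>, \<open>pp_max\<close> takes one
  of two unspecified values of \<open>Inf\<close>; measurability must hold there too, since the integral of a
  non-measurable function is \<open>0\<close> by convention.\<close>

lemma pp_max_measurable[measurable]: "(\<lambda>\<omega>. pp_max (Pp \<omega>)) \<in> borel_measurable L"
proof -
  have anti: "emeasure (Pp \<omega>) {y<..} \<le> emeasure (Pp \<omega>) {x<..}" if "x \<le> y" for x y \<omega>
    using that by (intro emeasure_mono) auto
  \<comment> \<open>Integer levels are enough by monotonicity, and they make both events countable
    combinations of measurable ones.\<close>
  define A where "A \<omega> \<longleftrightarrow> (\<exists>n::nat. emeasure (Pp \<omega>) {real n<..} = 0)" for \<omega>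
  define B where "B \<omega> \<longleftrightarrow> (\<exists>n::nat. emeasure (Pp \<omega>) {- real n<..} \<noteq> 0)" for \<omega>
  have [measurable]: "Measurable.pred L A" "Measurable.pred L B"
    unfolding A_def B_def by measurable
  define F where "F \<omega> = (if A \<omega> \<and> B \<omega> then pp_max (Pp \<omega>) else 0)" for \<omega>
  have nA: "pp_max (Pp \<omega>) = Inf {}" if "\<not> A \<omega>" for \<omega>
  proof -
    have "emeasure (Pp \<omega>) {t<..} \<noteq> 0" for t
    proof -
      obtain n where "t \<le> real n" using real_arch_simple by blast
      then show ?thesis using that anti[of t "real n" \<omega>] unfolding A_def by force
    qed
    then show ?thesis unfolding pp_max_def by simp
  qed
  have nB: "pp_max (Pp \<omega>) = Inf UNIV" if "\<not> B \<omega>" for \<omega>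
  proof -
    have "emeasure (Pp \<omega>) {t<..} = 0" for t
    proof -
      obtain n where "- t \<le> real n" using real_arch_simple by blast
      then have "- real n \<le> t" by simp
      then show ?thesis using that anti[of "- real n" t \<omega>] unfolding B_def by force
    qed
    then show ?thesis unfolding pp_max_def by simp
  qed
  have "F \<in> borel_measurable L"
    unfolding borel_measurable_iff_le
  proof
    fix a
    have "{\<omega> \<in> space L. F \<omega> \<le> a} =
      {\<omega> \<in> space L. if A \<omega> \<and> B \<omega> then emeasure (Pp \<omega>) {a<..} = 0 else 0 \<le> a}"
    proof (rule Collect_cong, rule conj_cong[OF refl])
      fix \<omega>
      have "pp_max (Pp \<omega>) \<le> a \<longleftrightarrow> emeasure (Pp \<omega>) {a<..} = 0" if "A \<omega> \<and> B \<omega>"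
        using that pp_max_le_iff[OF sets_Pp] unfolding A_def B_def by blast
      then show "(F \<omega> \<le> a) = (if A \<omega> \<and> B \<omega> then emeasure (Pp \<omega>) {a<..} = 0 else 0 \<le> a)"
        unfolding F_def by simp
    qed
    also have "\<dots> \<in> sets L" by measurable
    finally show "{\<omega> \<in> space L. F \<omega> \<le> a} \<in> sets L" .
  qed
  moreover have "(\<lambda>\<omega>. pp_max (Pp \<omega>)) =
    (\<lambda>\<omega>. if A \<omega> \<and> B \<omega> then F \<omega> else if A \<omega> then Inf UNIV else Inf {})"
    by (auto simp: F_def nA nB)
  ultimately show ?thesis by simp
qed

lemma laplace_functional_pp_max:
  fixes \<phi> :: "real \<Rightarrow> real"
  assumes \<phi>[measurable]: "\<phi> \<in> borel_measurable borel" and \<phi>0: "\<And>s. 0 \<le> \<phi> s" and \<phi>C: "\<And>s. \<phi> s \<le> C"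
    and K: "\<And>s. s \<le> - K \<Longrightarrow> \<phi> s = 0"
  shows "(\<integral>\<omega>. exp (- enn2real (\<integral>\<^sup>+s. ennreal (\<phi> s) \<partial>Pp \<omega>)) * indicator {..t} (pp_max (Pp \<omega>)) \<partial>L) =
      exp (- (\<integral>s. (1 - exp (- \<phi> s) * indicator {..t} s) * exp (- s) \<partial>lborel))" (is ?joint)
    and "(\<integral>\<omega>. exp (- enn2real (\<integral>\<^sup>+s. ennreal (\<phi> s) \<partial>Pp \<omega>)) \<partial>L) =
      exp (- (\<integral>s. (1 - exp (- \<phi> s)) * exp (- s) \<partial>lborel))" (is ?total)
    and "(\<lambda>\<omega>. \<integral>\<^sup>+s. ennreal (\<phi> s) \<partial>Pp \<omega>) \<in> borel_measurable L" (is ?meas)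
proof -
  show m[measurable]: ?meas
    by (rule laplace_functional(1)[where K=K]) (auto simp: K)
  \<comment> \<open>Finiteness is essential: at \<open>\<infinity>\<close> the weight
    \<open>exp (- enn2real x)\<close> would be \<open>1\<close> and \<open>exp_neg x\<close> would
    be \<open>0\<close>.\<close>
  have fin: "AE \<omega> in L. exp_neg (\<integral>\<^sup>+s. ennreal (\<phi> s) \<partial>Pp \<omega>) = exp (- enn2real (\<integral>\<^sup>+s. ennreal (\<phi> s) \<partial>Pp \<omega>))"
    using AE_finite_right[of "- K"]
  proof eventually_elim
    case (elim \<omega>)
    have "(\<integral>\<^sup>+s. ennreal (\<phi> s) \<partial>Pp \<omega>) \<le> (\<integral>\<^sup>+s. ennreal C * indicator {- K<..} s \<partial>Pp \<omega>)"
      using \<phi>C K by (intro nn_integral_mono) (auto simp: indicator_def not_less intro: ennreal_leI)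
    also have "\<dots> = ennreal C * emeasure (Pp \<omega>) {- K<..}"
      by (rule nn_integral_cmult_indicator) simp
    also have "\<dots> < \<top>" using elim by (simp add: ennreal_mult_less_top)
    finally show ?case by (simp add: exp_neg_def)
  qed
  have "(\<integral>\<omega>. exp (- enn2real (\<integral>\<^sup>+s. ennreal (\<phi> s) \<partial>Pp \<omega>)) \<partial>L) =
     (\<integral>\<omega>. exp_neg (\<integral>\<^sup>+s. ennreal (\<phi> s) \<partial>Pp \<omega>) \<partial>L)"
    by (rule integral_cong_AE) (use fin in auto)
  also have "\<dots> = exp (- (\<integral>s. (1 - exp_neg (ennreal (\<phi> s))) * exp (- s) \<partial>lborel))"
    by (rule laplace_functional(2)[where K=K]) (auto simp: K)
  finally show ?total by (simp add: exp_neg_ennreal \<phi>0)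
  \<comment> \<open>The infinite part turns the Laplace weight into \<open>0\<close> as soon as a
    point lies to the right of \<open>t\<close>. Left of \<open>- max K (- t)\<close> both parts
    vanish.\<close>
  define h where "h s = ennreal (\<phi> s) + \<infinity> * indicator {t<..} s" for s
  have [measurable]: "h \<in> borel_measurable borel" unfolding h_def by measurable
  have h: "exp_neg (h s) = exp (- \<phi> s) * indicator {..t} s" for s
    unfolding h_def exp_neg_add by (auto simp: exp_neg_ennreal \<phi>0 indicator_def)
  have "(\<integral>\<omega>. exp (- enn2real (\<integral>\<^sup>+s. ennreal (\<phi> s) \<partial>Pp \<omega>)) * indicator {..t} (pp_max (Pp \<omega>)) \<partial>L) =
     (\<integral>\<omega>. exp_neg (\<integral>\<^sup>+s. h s \<partial>Pp \<omega>) \<partial>L)"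
  proof (rule integral_cong_AE)
    show "(\<lambda>\<omega>. exp_neg (\<integral>\<^sup>+s. h s \<partial>Pp \<omega>)) \<in> borel_measurable L"
      by (intro measurable_compose[OF laplace_functional(1)[where K="max K (- t)"] exp_neg_measurable])
         (auto simp: h_def K)
    show "AE \<omega> in L. exp (- enn2real (\<integral>\<^sup>+s. ennreal (\<phi> s) \<partial>Pp \<omega>)) * indicator {..t} (pp_max (Pp \<omega>)) =
       exp_neg (\<integral>\<^sup>+s. h s \<partial>Pp \<omega>)"
      using fin AE_pp_max_le_iff
    proof eventually_elim
      case (elim \<omega>)
      have "(\<integral>\<^sup>+s. h s \<partial>Pp \<omega>) = (\<integral>\<^sup>+s. ennreal (\<phi> s) \<partial>Pp \<omega>) + (\<integral>\<^sup>+s. \<infinity> * indicator {t<..} s \<partial>Pp \<omega>)"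
        unfolding h_def by (rule nn_integral_add) auto
      also have "(\<integral>\<^sup>+s. \<infinity> * indicator {t<..} s \<partial>Pp \<omega>) = \<infinity> * emeasure (Pp \<omega>) {t<..}"
        by (rule nn_integral_cmult_indicator) simp
      finally show ?case
        using elim by (auto simp: exp_neg_add indicator_def ennreal_top_mult)
    qed
  qed simp
  also have "\<dots> = exp (- (\<integral>s. (1 - exp_neg (h s)) * exp (- s) \<partial>lborel))"
    by (rule laplace_functional(2)[where K="max K (- t)"]) (auto simp: h_def K)
  finally show ?joint unfolding h .
qed

end

section \<open>Joint convergence\<close>

lemma (in prob_space) real_distribution_weighted:
  assumes [measurable]: "X \<in> borel_measurable M" "w \<in> borel_measurable M"
    and w: "\<And>x. 0 \<le> w x" "\<And>x. w x \<le> 1" and pos: "0 < (\<integral>x. w x \<partial>M)"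
  shows "real_distribution (distr (density M (\<lambda>x. ennreal (w x / (\<integral>x. w x \<partial>M)))) borel X)"
    and "f \<in> borel_measurable borel \<Longrightarrow>
      (\<integral>z. f z \<partial>distr (density M (\<lambda>x. ennreal (w x / (\<integral>x. w x \<partial>M)))) borel X) =
      (\<integral>x. w x * f (X x) \<partial>M) / (\<integral>x. w x \<partial>M :: real)"
proof -
  let ?m = "\<integral>x. w x \<partial>M"
  have iw: "integrable M w" by (rule integrable_const_bound[where B=1]) (use w in auto)
  have "(\<integral>\<^sup>+x. ennreal (w x / ?m) \<partial>M) = ennreal (\<integral>x. w x / ?m \<partial>M)"
    by (rule nn_integral_eq_integral) (use w pos iw in auto)
  also have "\<dots> = 1" using pos by simp
  finally have "prob_space (density M (\<lambda>x. ennreal (w x / ?m)))"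
    by (intro prob_spaceI) (simp add: emeasure_density cong: nn_integral_cong)
  then show "real_distribution (distr (density M (\<lambda>x. ennreal (w x / ?m))) borel X)"
    by (rule prob_space.real_distribution_distr) simp
  assume [measurable]: "f \<in> borel_measurable borel"
  show "(\<integral>z. f z \<partial>distr (density M (\<lambda>x. ennreal (w x / ?m))) borel X) = (\<integral>x. w x * f (X x) \<partial>M) / ?m"
    using w pos by (subst integral_distr, simp, simp, subst integral_density) auto
qed

text \<open>Divided by their total masses, the weights turn the laws of \<open>X n\<close> into
  probability laws whose distribution functions converge at every point. Weak convergence then gives
  the integrals of \<open>h\<close>, and multiplying back by the masses, which converge too, removes
  the normalisation. The shift by \<open>n0\<close> skips the indices where the mass could be
  zero.\<close>

lemma weighted_weak_conv:
  fixes W X :: "nat \<Rightarrow> 'a \<Rightarrow> real" and w x :: "'b \<Rightarrow> real"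
  assumes M: "prob_space M" and L: "prob_space L"
    and mX: "\<And>n. X n \<in> borel_measurable M" and mW: "\<And>n. W n \<in> borel_measurable M"
    and mx: "x \<in> borel_measurable L" and mw: "w \<in> borel_measurable L"
    and W: "\<And>n \<omega>. 0 \<le> W n \<omega>" "\<And>n \<omega>. W n \<omega> \<le> 1" and w: "\<And>\<omega>. 0 \<le> w \<omega>" "\<And>\<omega>. w \<omega> \<le> 1"
    and pos: "0 < (\<integral>\<omega>. w \<omega> \<partial>L)"
    and total: "(\<lambda>n. \<integral>\<omega>. W n \<omega> \<partial>M) \<longlonglongrightarrow> (\<integral>\<omega>. w \<omega> \<partial>L)"
    and below: "\<And>t. (\<lambda>n. \<integral>\<omega>. W n \<omega> * indicator {..t} (X n \<omega>) \<partial>M) \<longlonglongrightarrow> (\<integral>\<omega>. w \<omega> * indicator {..t} (x \<omega>) \<partial>L)"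
    and h: "bounded_continuous h"
  shows "(\<lambda>n. \<integral>\<omega>. W n \<omega> * h (X n \<omega>) \<partial>M) \<longlonglongrightarrow> (\<integral>\<omega>. w \<omega> * h (x \<omega>) \<partial>L)"
proof -
  interpret M: prob_space M by fact
  interpret L: prob_space L by fact
  have hc: "continuous_on UNIV h" using h by (simp add: bounded_continuous_def)
  have [measurable]: "h \<in> borel_measurable borel" using hc by (rule borel_measurable_continuous_onI)
  obtain B where B: "\<And>z. norm (h z) \<le> B"
    using h unfolding bounded_continuous_def bounded_iff by auto
  let ?C = "\<lambda>n. \<integral>\<omega>. W n \<omega> \<partial>M" and ?c = "\<integral>\<omega>. w \<omega> \<partial>L"
  have "\<forall>\<^sub>F n in sequentially. 0 < ?C n" using order_tendstoD(1)[OF total pos] .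
  then obtain n0 where n0: "\<And>n. n \<ge> n0 \<Longrightarrow> 0 < ?C n" unfolding eventually_sequentially by blast
  define D where "D n = distr (density M (\<lambda>\<omega>. ennreal (W (n + n0) \<omega> / ?C (n + n0)))) borel (X (n + n0))" for n
  define d where "d = distr (density L (\<lambda>\<omega>. ennreal (w \<omega> / ?c))) borel x"
  have D: "real_distribution (D n)" for n
    unfolding D_def using W n0 by (intro M.real_distribution_weighted mX mW) auto
  have d: "real_distribution d"
    unfolding d_def using w pos by (intro L.real_distribution_weighted mx mw) auto
  have ID: "(\<integral>z. f z \<partial>D n) = (\<integral>\<omega>. W (n + n0) \<omega> * f (X (n + n0) \<omega>) \<partial>M) / ?C (n + n0)"
    if "f \<in> borel_measurable borel" for n f
    unfolding D_def using W n0 that by (intro M.real_distribution_weighted mX mW) auto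
  have Id: "(\<integral>z. f z \<partial>d) = (\<integral>\<omega>. w \<omega> * f (x \<omega>) \<partial>L) / ?c" if "f \<in> borel_measurable borel" for f
    unfolding d_def using w pos that by (intro L.real_distribution_weighted mx mw) auto
  have total': "(\<lambda>n. ?C (n + n0)) \<longlonglongrightarrow> ?c" using total by (rule LIMSEQ_ignore_initial_segment)
  have "weak_conv_m D d"
    unfolding weak_conv_m_def weak_conv_def
  proof (intro allI impI)
    fix t
    have cdfI: "cdf N t = (\<integral>z. indicator {..t} z \<partial>N)" if "real_distribution N" for N
    proof -
      interpret real_distribution N by fact
      show ?thesis by (simp add: cdf_def)
    qed
    have I: "(indicator {..t} :: real \<Rightarrow> real) \<in> borel_measurable borel" by simp
    have "(\<lambda>n. (\<integral>\<omega>. W (n + n0) \<omega> * indicator {..t} (X (n + n0) \<omega>) \<partial>M) / ?C (n + n0)) \<longlonglongrightarrow>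
       (\<integral>\<omega>. w \<omega> * indicator {..t} (x \<omega>) \<partial>L) / ?c"
      using pos by (intro tendsto_divide total' LIMSEQ_ignore_initial_segment[OF below]) auto
    then show "(\<lambda>n. cdf (D n) t) \<longlonglongrightarrow> cdf d t"
      unfolding cdfI[OF D] cdfI[OF d] ID[OF I] Id[OF I] .
  qed
  then have "(\<lambda>n. \<integral>z. h z \<partial>D n) \<longlonglongrightarrow> (\<integral>z. h z \<partial>d)"
    by (rule weak_conv_imp_integral_bdd_continuous_conv[OF D d])
       (use hc B in \<open>auto simp: continuous_on_eq_continuous_at\<close>)
  then have "(\<lambda>n. (\<integral>z. h z \<partial>D n) * ?C (n + n0)) \<longlonglongrightarrow> (\<integral>z. h z \<partial>d) * ?c"
    by (intro tendsto_mult total')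
  moreover have "(\<integral>z. h z \<partial>D n) * ?C (n + n0) = (\<integral>\<omega>. W (n + n0) \<omega> * h (X (n + n0) \<omega>) \<partial>M)" for n
    using n0[of "n + n0"] by (simp add: ID)
  moreover have "(\<integral>z. h z \<partial>d) * ?c = (\<integral>\<omega>. w \<omega> * h (x \<omega>) \<partial>L)"
    using pos by (simp add: Id)
  ultimately have "(\<lambda>n. \<integral>\<omega>. W (n + n0) \<omega> * h (X (n + n0) \<omega>) \<partial>M) \<longlonglongrightarrow> (\<integral>\<omega>. w \<omega> * h (x \<omega>) \<partial>L)"
    by simp
  then show ?thesis by (rule LIMSEQ_offset)
qed

lemma cdf_gumbel: "cdf gumbel t = exp (- exp (- t))"
proof -
  have "emeasure gumbel {..t} = (\<integral>\<^sup>+s. ennreal (exp (- s - exp (- s))) * indicator {..t} s \<partial>lborel)"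
    unfolding gumbel_def by (subst emeasure_density) auto
  \<comment> \<open>Reflection moves the integral to a half-line unbounded on the right, where the
    fundamental theorem applies.\<close>
  also have "\<dots> = (\<integral>\<^sup>+s. ennreal (exp (- (- s) - exp (- (- s)))) * indicator {..t} (- s) \<partial>lborel)"
    using nn_integral_real_affine[of "\<lambda>s. ennreal (exp (- s - exp (- s))) * indicator {..t} s" "- 1" 0] by simp
  also have "\<dots> = (\<integral>\<^sup>+s. ennreal (exp (s - exp s)) * indicator {- t..} s \<partial>lborel)"
    by (intro nn_integral_cong) (auto simp: indicator_def)
  also have "\<dots> = ennreal (0 - (- exp (- exp (- t))))"
  proof (rule nn_integral_FTC_atLeast)
    show "((\<lambda>s::real. - exp (- exp s)) \<longlongrightarrow> 0) at_top" by real_asymp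
    show "((\<lambda>s::real. - exp (- exp s)) has_real_derivative exp (x - exp x)) (at x)" for x
      by (auto intro!: derivative_eq_intros simp: exp_diff exp_minus field_simps)
  qed auto
  finally show ?thesis by (simp add: cdf_def measure_def)
qed

theorem theorem3p1:
  fixes r :: nat and adj :: "'v \<Rightarrow> 'v \<Rightarrow> bool"
    and M :: "'a measure" and psi :: "'v \<Rightarrow> 'a \<Rightarrow> real"
    and V :: "nat \<Rightarrow> 'v set"
    and L :: "'b measure" and Pp :: "'b \<Rightarrow> real measure"
  assumes r: "r \<ge> 3"
    and tree: "infinite_regular_tree r adj"
    and gff: "centred_gaussian_field M psi (tree_green r adj)"
    and subtrees: "\<And>N. is_subtree adj (V N) \<and> card (V N) = N"
    and ppp: "is_PPP_exp L Pp"
  defines "Y \<equiv> \<lambda>N x \<omega>. (psi x \<omega> / sqrt ((real r - 1) / (real r - 2)) - aN N) / bN N"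
    and "MN \<equiv> \<lambda>N \<omega>. Max ((\<lambda>x. (psi x \<omega> / sqrt ((real r - 1) / (real r - 2)) - aN N) / bN N) ` V N)"
  shows "(\<forall>\<phi> h. pp_test_fun \<phi> \<longrightarrow> bounded_continuous h \<longrightarrow>
           ((\<lambda>N. \<integral>\<omega>. exp (- (\<Sum>x\<in>V N. \<phi> (Y N x \<omega>))) * h (MN N \<omega>) \<partial>M)
            \<longlonglongrightarrow> (\<integral>\<omega>. exp (- enn2real (\<integral>\<^sup>+ s. ennreal (\<phi> s) \<partial>(Pp \<omega>)))
                          * h (pp_max (Pp \<omega>)) \<partial>L)))
         \<and> weak_conv_m (\<lambda>N. distr M borel (MN N)) gumbel"
proof -
  interpret T: regular_tree r adj by unfold_locales (use r tree in auto)
  interpret G: gaussian_field M "\<lambda>x \<omega>. psi x \<omega> / sqrt ((real r - 1) / (real r - 2))" T.green_corr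
    by (rule T.gaussian_field_normalised[OF gff])
  interpret PP: poisson_exp L Pp
  proof -
    interpret prob_space L using ppp by (simp add: is_PPP_exp_def)
    show "poisson_exp L Pp" by unfold_locales (rule ppp)
  qed
  have V: "finite (V N)" "card (V N) = N" for N
    using subtrees[of N] by (auto simp: is_subtree_def)
  have Y_measurable[measurable]: "Y N x \<in> borel_measurable M" for N x
    unfolding Y_def using G.Z_measurable[of x] by measurable
  have MN_Y: "MN N \<omega> = Max ((\<lambda>x. Y N x \<omega>) ` V N)" for N \<omega>
    unfolding MN_def Y_def ..
  have MN_measurable[measurable]: "MN N \<in> borel_measurable M" for N
  proof -
    have "(\<lambda>\<omega>. Max ((\<lambda>x. Y N x \<omega>) ` V N)) \<in> borel_measurable M"
      using V by (intro borel_measurable_Max) auto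
    then show ?thesis by (simp add: MN_Y[abs_def])
  qed
  have core: "(\<lambda>N. \<integral>\<omega>. (\<Prod>x\<in>V N. f (Y N x \<omega>)) \<partial>M) \<longlonglongrightarrow> exp (- (\<integral>s. (1 - f s) * exp (- s) \<partial>lborel))"
    if f: "antimono f" "\<And>s. 0 \<le> f s" "\<And>s. f s \<le> 1" "\<And>s. s < - K \<Longrightarrow> f s = 1" for f :: "real \<Rightarrow> real" and K
  proof -
    have "(\<lambda>N. \<integral>\<omega>. (\<Prod>x\<in>V N. 1 - (1 - f ((psi x \<omega> / sqrt ((real r - 1) / (real r - 2)) - aN N) * aN N))) \<partial>M)
        \<longlonglongrightarrow> exp (- (\<integral>s. (1 - f s) * exp (- s) \<partial>lborel))"
    proof (rule G.prod_integral_tendsto[where K=K])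
      show "mono (\<lambda>s. 1 - f s)" using f(1) by (auto simp: mono_def antimono_def)
    qed (use f V T.green_corr_le_half T.green_corr_near in auto)
    then show ?thesis unfolding Y_def bN_def by simp
  qed
  have below: "(\<lambda>N. \<integral>\<omega>. exp (- (\<Sum>x\<in>V N. \<phi> (Y N x \<omega>))) * indicator {..t} (MN N \<omega>) \<partial>M) \<longlonglongrightarrow>
      exp (- (\<integral>s. (1 - exp (- \<phi> s) * indicator {..t} s) * exp (- s) \<partial>lborel))"
    if \<phi>: "mono \<phi>" "\<And>s. 0 \<le> \<phi> s" "\<And>s. s \<le> - K \<Longrightarrow> \<phi> s = 0" for \<phi> :: "real \<Rightarrow> real" and K t
  proof (rule Lim_transform_eventually)
    \<comment> \<open>The product of the indicators over the vertices is the indicator that the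
      maximum is at most \<open>t\<close>. The function is \<open>1\<close> to the left of
      \<open>- max K (- t)\<close>, before either \<open>\<phi>\<close> or the cut takes
      effect.\<close>
    let ?f = "\<lambda>s. exp (- \<phi> s) * indicator {..t} s :: real"
    show "(\<lambda>N. \<integral>\<omega>. (\<Prod>x\<in>V N. ?f (Y N x \<omega>)) \<partial>M) \<longlonglongrightarrow> exp (- (\<integral>s. (1 - ?f s) * exp (- s) \<partial>lborel))"
    proof (rule core[of _ "max K (- t)"])
      show "antimono ?f"
        using \<phi>(1) by (auto simp: antimono_def mono_def indicator_def)
      show "?f s \<le> 1" for s using \<phi>(2)[of s] by (auto simp: indicator_def)
    qed (use \<phi> in auto)
    show "\<forall>\<^sub>F N in sequentially. (\<integral>\<omega>. (\<Prod>x\<in>V N. ?f (Y N x \<omega>)) \<partial>M) =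
        (\<integral>\<omega>. exp (- (\<Sum>x\<in>V N. \<phi> (Y N x \<omega>))) * indicator {..t} (MN N \<omega>) \<partial>M)"
    proof (rule eventually_sequentiallyI[of 1], rule Bochner_Integration.integral_cong[OF refl])
      \<comment> \<open>The set \<open>V 0\<close> is empty and \<open>Max {}\<close> is
        unspecified, so the identity is claimed from \<open>N = 1\<close> on.\<close>
      fix N :: nat and \<omega> assume "1 \<le> N"
      then have ne: "V N \<noteq> {}" using V(2)[of N] by auto
      have "(\<Prod>x\<in>V N. indicator {..t} (Y N x \<omega>)) = (indicator {..t} (MN N \<omega>) :: real)"
        using V(1)[of N] ne unfolding MN_Y
        by (auto simp: indicator_def prod_zero_iff not_le)
      then show "(\<Prod>x\<in>V N. ?f (Y N x \<omega>)) =
          exp (- (\<Sum>x\<in>V N. \<phi> (Y N x \<omega>))) * indicator {..t} (MN N \<omega>)"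
        using V(1)[of N] by (simp add: prod.distrib exp_sum sum_negf[symmetric])
    qed
  qed
  have total: "(\<lambda>N. \<integral>\<omega>. exp (- (\<Sum>x\<in>V N. \<phi> (Y N x \<omega>))) \<partial>M) \<longlonglongrightarrow>
      exp (- (\<integral>s. (1 - exp (- \<phi> s)) * exp (- s) \<partial>lborel))"
    if \<phi>: "mono \<phi>" "\<And>s. 0 \<le> \<phi> s" "\<And>s. s \<le> - K \<Longrightarrow> \<phi> s = 0" for \<phi> :: "real \<Rightarrow> real" and K
  proof -
    have "(\<lambda>N. \<integral>\<omega>. (\<Prod>x\<in>V N. exp (- \<phi> (Y N x \<omega>))) \<partial>M) \<longlonglongrightarrow>
      exp (- (\<integral>s. (1 - exp (- \<phi> s)) * exp (- s) \<partial>lborel))"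
      by (rule core[of _ K]) (use \<phi> in \<open>auto simp: antimono_def mono_def\<close>)
    then show ?thesis using V(1) by (simp add: exp_sum sum_negf[symmetric])
  qed
  have joint: "(\<lambda>N. \<integral>\<omega>. exp (- (\<Sum>x\<in>V N. \<phi> (Y N x \<omega>))) * h (MN N \<omega>) \<partial>M) \<longlonglongrightarrow>
      (\<integral>\<omega>. exp (- enn2real (\<integral>\<^sup>+ s. ennreal (\<phi> s) \<partial>(Pp \<omega>))) * h (pp_max (Pp \<omega>)) \<partial>L)"
    if test: "pp_test_fun \<phi>" and h: "bounded_continuous h" for \<phi> h
  proof -
    obtain K where mono: "mono \<phi>" and K: "\<And>s. s \<le> - K \<Longrightarrow> \<phi> s = 0" "\<And>s. s \<ge> K \<Longrightarrow> \<phi> s = \<phi> K"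
      using test unfolding pp_test_fun_def by blast
    have [measurable]: "\<phi> \<in> borel_measurable borel" using mono by (rule borel_measurable_mono)
    \<comment> \<open>A test function is nonnegative because it increases from the value
      \<open>0\<close> on the far left.\<close>
    have \<phi>0: "0 \<le> \<phi> s" for s
      using monoD[OF mono, of "min s (- K)" s] K(1)[of "min s (- K)"] by simp
    have \<phi>C: "\<phi> s \<le> \<phi> K" for s
      using monoD[OF mono, of s "max s K"] K(2)[of "max s K"] by simp
    note laplace = PP.laplace_functional_pp_max[of \<phi> "\<phi> K" K, OF _ \<phi>0 \<phi>C K(1), simplified]
    have [measurable]: "(\<lambda>\<omega>. \<integral>\<^sup>+s. ennreal (\<phi> s) \<partial>Pp \<omega>) \<in> borel_measurable L"
      by (rule laplace(3))
    show ?thesis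
    proof (rule weighted_weak_conv[OF G.prob_space_axioms PP.prob_space_axioms _ _ _ _ _ _ _ _ _ _ _ h])
      show "0 < (\<integral>\<omega>. exp (- enn2real (\<integral>\<^sup>+ s. ennreal (\<phi> s) \<partial>(Pp \<omega>))) \<partial>L)"
        unfolding laplace(2) by simp
      show "(\<lambda>N. \<integral>\<omega>. exp (- (\<Sum>x\<in>V N. \<phi> (Y N x \<omega>))) \<partial>M) \<longlonglongrightarrow>
          (\<integral>\<omega>. exp (- enn2real (\<integral>\<^sup>+ s. ennreal (\<phi> s) \<partial>(Pp \<omega>))) \<partial>L)"
        unfolding laplace(2) by (rule total[of _ K]) (use mono \<phi>0 K(1) in auto)
      show "(\<lambda>N. \<integral>\<omega>. exp (- (\<Sum>x\<in>V N. \<phi> (Y N x \<omega>))) * indicator {..t} (MN N \<omega>) \<partial>M) \<longlonglongrightarrow>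
          (\<integral>\<omega>. exp (- enn2real (\<integral>\<^sup>+ s. ennreal (\<phi> s) \<partial>(Pp \<omega>))) * indicator {..t} (pp_max (Pp \<omega>)) \<partial>L)" for t
        unfolding laplace(1) by (rule below[of _ K]) (use mono \<phi>0 K(1) in auto)
      show "exp (- (\<Sum>x\<in>V N. \<phi> (Y N x \<omega>))) \<le> 1" for N \<omega>
        using \<phi>0 by (simp add: sum_nonneg)
    qed simp_all
  qed
  have "(\<lambda>N. cdf (distr M borel (MN N)) t) \<longlonglongrightarrow> cdf gumbel t" for t
  proof -
    \<comment> \<open>For \<open>\<phi> = 0\<close> the weight is one and \<open>below\<close> gives
      the distribution function of the maximum itself; \<open>{t<..}\<close> and
      \<open>{t..}\<close> differ by a null set.\<close>
    have "(\<integral>s. (1 - exp (- 0) * indicator {..t} s) * exp (- s) \<partial>lborel) =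
        (\<integral>s. indicator {t..} s * exp (- s) \<partial>lborel)"
    proof (rule integral_cong_AE)
      show "AE s in lborel. (1 - exp (- 0) * indicator {..t} s) * exp (- s) = indicator {t..} s * exp (- s)"
        using AE_lborel_singleton[of t] by eventually_elim (auto simp: indicator_def)
    qed simp_all
    also have "\<dots> = exp (- t)"
      using has_bochner_integral_exp_atLeast[of t] by (simp add: has_bochner_integral_iff)
    finally have "(\<lambda>N. \<integral>\<omega>. indicator {..t} (MN N \<omega>) \<partial>M) \<longlonglongrightarrow> cdf gumbel t"
      using below[of "\<lambda>_. 0" 0 t] by (simp add: cdf_gumbel mono_def)
    moreover have "cdf (distr M borel (MN N)) t = (\<integral>\<omega>. indicator {..t} (MN N \<omega>) \<partial>M)" for N
    proof -
      have "cdf (distr M borel (MN N)) t = (\<integral>z. indicator {..t} z \<partial>distr M borel (MN N))"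
        by (simp add: cdf_def)
      also have "\<dots> = (\<integral>\<omega>. indicator {..t} (MN N \<omega>) \<partial>M)" by (rule integral_distr) simp_all
      finally show ?thesis .
    qed
    ultimately show ?thesis by simp
  qed
  then have "weak_conv_m (\<lambda>N. distr M borel (MN N)) gumbel"
    by (simp add: weak_conv_m_def weak_conv_def)
  with joint show ?thesis by blast
qed

end
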